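(* Let $q=p^k$ be a prime power with $p\neq 2,3$. Then the projective norm graph $\mathrm{NG}(q,4)$ contains at least $(q^3-1)(q-1)(q^3-24)$ (distinct) subgraphs isomorphic to $K_{4,6}$, i.e. sets consisting of $4+6$ distinct vertices such that each of the $4$ vertices is adjacent to each of the $6$ vertices.
   Context: $N:\mathbb{F}_{q^{3}}\to\mathbb{F}_q$ denotes the norm $N(A)=A^{1+q+q^2}$. The projective norm graph $\mathrm{NG}(q,4)$ has vertex set $\mathbb{F}_{q^{3}}\times\mathbb{F}_q^*$, and distinct vertices $(A,a)$, $(B,b)$ are adjacent iff $N(A+B)=ab$. *)

theory Defs
  imports Complex_Main "HOL-Library.Cardinality" "HOL-Computational_Algebra.Primes" "Graph_Theory.Kuratowski"
begin

definition is_subfield :: "'a::field set \<Rightarrow> bool" where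
  "is_subfield F \<longleftrightarrow>
     0 \<in> F \<and> 1 \<in> F \<and>
     (\<forall>x\<in>F. \<forall>y\<in>F. x + y \<in> F \<and> x * y \<in> F) \<and>
     (\<forall>x\<in>F. - x \<in> F \<and> inverse x \<in> F)"

definition cubic_norm :: "nat \<Rightarrow> 'a::field \<Rightarrow> 'a" where
  "cubic_norm q x = x ^ (1 + q + q\<^sup>2)"

(* NG(q,4), where the ambient type is the field with q^3 elements and F is its subfield
   with q elements.  As in Graph_Theory, an undirected simple graph is a loop-free symmetric
   digraph: each edge {u,v} is the pair of arcs (u,v), (v,u). *)
definition projective_norm_graph4 :: "nat \<Rightarrow> 'a::field set \<Rightarrow> ('a \<times> 'a) pair_pre_digraph" where
  "projective_norm_graph4 q F =
     \<lparr> pverts = UNIV \<times> (F - {0}),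
       parcs = {((A, a), (B, b)) | A a B b.
                  a \<in> F - {0} \<and> b \<in> F - {0} \<and> (A, a) \<noteq> (B, b) \<and>
                  cubic_norm q (A + B) = a * b} \<rparr>"

lemma pair_graph_projective_norm_graph4:
  fixes F :: "'a::{field,finite} set"
  shows "pair_graph (projective_norm_graph4 q F)"
  by unfold_locales
    (auto simp: projective_norm_graph4_def symmetric_def add.commute mult.commute intro!: symI)

(* The copies of K_{m,n} in G, as subgraphs (not as embeddings): each is determined by its
   vertex set and its arc set. *)
definition bipartite_copies :: "nat \<Rightarrow> nat \<Rightarrow> 'v pair_pre_digraph \<Rightarrow> 'v pair_pre_digraph set" where
  "bipartite_copies m n G = {H. subgraph (with_proj H) (with_proj G) \<and> K\<^bsub>m,n\<^esub> (with_proj H)}"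

end

theory Submission
  imports Defs "HOL-Algebra.Algebraic_Closure_Type" "HOL-Library.Product_Plus"
begin

hide_const (open) Divisibility.prime

text \<open>
  Write \<open>K\<close> for the field with \<open>q\<^sup>3\<close> elements. One configuration of four points \<open>A\<close> and six points
  \<open>B\<close> with \<open>N(x + y) = a(x) b(y)\<close> yields all the copies: translations \<open>(x, y) \<mapsto> (x + C, y - C)\<close>,
  dilations by \<open>K\<^sup>*\<close> and rescaling of the labels by the nonzero elements of the subfield move it
  to \<open>q\<^sup>3 (q\<^sup>3 - 1) (q - 1)\<close> places, and for every dilation at most \<open>24 = 4 * 6\<close> translations make
  the two sides meet. After a homography it suffices to find three points \<open>d\<close> (the fourth being
  infinity) and six points \<open>y\<close> such that \<open>N(y - d)\<close> is nonzero and does not depend on \<open>y\<close>.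

  The three points are a Frobenius orbit \<open>\<alpha>, \<alpha>', \<alpha>''\<close>, and the six points are an orbit
  \<open>\<beta>, \<beta>', \<beta>''\<close> and three points of the subfield. Expanding the norms in
  the Cardano coordinates \<open>\<alpha> = m + w\<close>, \<open>\<beta> = s + r m + t w\<close> turns the equations into a
  two-parameter family. On the curve \<open>r t = - 1\<close>, \<open>s = 2\<close> the remaining cubic splits. With
  \<open>a = r\<^sup>3\<close> one gets \<open>m\<^sup>3 = (a - 1) (a + 1)\<^sup>2 / a\<^sup>2\<close>, \<open>m w = (1 - a\<^sup>2) / a\<close>, the rational points
  \<open>x = (a + 1) / r - (a - 1) / r\<^sup>2\<close> for the three cube roots \<open>r\<close> of \<open>a\<close>, and the
  common norm \<open>2 (a + 1 / a)\<^sup>2\<close>. All of this lives in \<open>K\<close> as soon as \<open>(a - 1) / (a + 1)\<close>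
  is not a cube, and such an \<open>a\<close> exists unless \<open>q\<close> is 5, 7 or 13. In these three cases there is
  no configuration of this kind, but there are others.
\<close>

section \<open>From one configuration to many copies\<close>

definition biclique :: "'v set \<Rightarrow> 'v set \<Rightarrow> 'v pair_pre_digraph" where
  "biclique U V = \<lparr> pverts = U \<union> V, parcs = U \<times> V \<union> V \<times> U \<rparr>"

lemma biclique_in_bipartite_copies:
  assumes "pair_wf_digraph G" "finite U" "finite V" "card U = m" "card V = n" "U \<inter> V = {}"
    and "U \<union> V \<subseteq> pverts G" "U \<times> V \<subseteq> parcs G" "V \<times> U \<subseteq> parcs G"
  shows "biclique U V \<in> bipartite_copies m n G"
proof -
  have "pair_wf_digraph (biclique U V)"
    by unfold_locales (auto simp: biclique_def)
  then show ?thesis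
    using assms
    unfolding bipartite_copies_def complete_bipartite_digraph_pair_def subgraph_def wf_digraph_wp_iff
    by (auto simp: biclique_def)
qed

text \<open>The neighbourhood of a vertex of \<open>U\<close> is \<open>V\<close>. If that vertex
  lay in \<open>V'\<close>, its neighbourhood would be \<open>U'\<close>, which has \<open>m\<close>
  and not \<open>n\<close> elements. So the different sizes tell the two sides apart.\<close>

lemma biclique_eq_imp:
  assumes eq: "biclique U V = biclique U' V'" and "U \<inter> V = {}" "U' \<inter> V' = {}"
    and card: "card U = m" "card U' = m" "card V = n" "card V' = n"
    and "m \<noteq> n" "0 < m" "0 < n"
  shows "U = U' \<and> V = V'"
proof -
  have arcs: "U \<times> V \<union> V \<times> U = U' \<times> V' \<union> V' \<times> U'" and verts: "U \<union> V = U' \<union> V'"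
    using eq by (auto simp: biclique_def)
  obtain u where u: "u \<in> U" using assms by fastforce
  have V: "V = {v. (u, v) \<in> U \<times> V \<union> V \<times> U}"
    using u assms(2) by auto
  have "u \<in> U'"
  proof (rule ccontr)
    assume "u \<notin> U'"
    then have "u \<in> V'" using u verts by auto
    then have "V = U'" using V assms(3) unfolding arcs by auto
    then show False using assms by auto
  qed
  then have "V = V'" using V assms(3) unfolding arcs by auto
  then show ?thesis using verts assms(2,3) by auto
qed

lemma finite_bipartite_copies:
  fixes G :: "'v::finite pair_pre_digraph"
  shows "finite (bipartite_copies m n G)"
proof (rule finite_subset)
  show "bipartite_copies m n G \<subseteq> (\<lambda>(P, E). \<lparr>pverts = P, parcs = E\<rparr>) ` UNIV"
  proof
    fix H assume "H \<in> bipartite_copies m n G"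
    show "H \<in> (\<lambda>(P, E). \<lparr>pverts = P, parcs = E\<rparr>) ` UNIV"
      by (rule image_eqI[of _ _ "(pverts H, parcs H)"]) auto
  qed
qed auto

section \<open>The norm and the subfield with \<open>q\<close> elements\<close>

lemma cubic_norm_0 [simp]: "cubic_norm q 0 = 0"
  by (simp add: cubic_norm_def)

lemma cubic_norm_mult: "cubic_norm q (x * y) = cubic_norm q x * cubic_norm q y"
  unfolding cubic_norm_def by (rule power_mult_distrib)

lemma cubic_norm_minus: "cubic_norm q (- x) = - cubic_norm q x"
proof -
  have "odd (1 + q + q\<^sup>2)" by (auto simp: power2_eq_square)
  then show ?thesis unfolding cubic_norm_def by (rule power_minus_odd)
qed

lemma cubic_norm_eq_0_iff [simp]: "cubic_norm q x = 0 \<longleftrightarrow> x = 0"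
  by (auto simp: cubic_norm_def)

text \<open>Multiplication by a nonzero \<open>x\<close> permutes \<open>F - {0}\<close>; comparing
  the products over this set gives \<open>x ^ card (F - {0}) = 1\<close>.\<close>

lemma subfield_power_card:
  fixes F :: "'a::field set"
  assumes F: "is_subfield F" and fin: "finite F" and x: "x \<in> F"
  shows "x ^ card F = x"
proof (cases "x = 0")
  case False
  have "0 \<in> F" using F by (simp add: is_subfield_def)
  then have card: "card F = Suc (card (F - {0}))"
    using fin by (metis card.remove)
  have closed: "y * x \<in> F - {0} \<and> y / x \<in> F - {0}" if "y \<in> F - {0}" for y
    using that x False F by (auto simp: is_subfield_def divide_inverse)
  have "(\<Prod>y\<in>F-{0}. y * x) = \<Prod>(F - {0})"
    by (rule prod.reindex_bij_witness[of _ "\<lambda>y. y / x" "\<lambda>y. y * x"])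
      (use False closed in auto)
  then have "x ^ card (F - {0}) * \<Prod>(F - {0}) = \<Prod>(F - {0})"
    by (simp add: prod.distrib mult.commute)
  then have "x ^ card (F - {0}) = 1" using fin by simp
  then show ?thesis by (simp add: card)
next
  case True
  have "card F \<noteq> 0" using fin x by auto
  then show ?thesis using True by simp
qed

lemma power_card_UNIV:
  fixes x :: "'a::{field,finite}"
  shows "x ^ CARD('a) = x"
  by (rule subfield_power_card) (auto simp: is_subfield_def)

lemma fixed_points_of_power:
  assumes "q \<ge> 2"
  shows "finite {x::'a::idom. x ^ q = x}" "card {x::'a. x ^ q = x} \<le> q"
proof -
  define P :: "'a poly" where "P = monom 1 q - monom 1 1"
  have "degree P \<le> q"
    unfolding P_def using assms
    by (intro degree_diff_le) (auto intro: order.trans[OF degree_monom_le])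
  have "coeff P q = 1" using assms by (simp add: P_def)
  then have "P \<noteq> 0" by auto
  moreover have "{x. x ^ q = x} = {x. poly P x = 0}" by (auto simp: P_def poly_monom)
  ultimately show "finite {x::'a. x ^ q = x}" "card {x::'a. x ^ q = x} \<le> q"
    using poly_roots_finite[of P] card_poly_roots_bound[of P] \<open>degree P \<le> q\<close> by simp_all
qed

text \<open>The \<open>q\<close> elements of \<open>F\<close> already exhaust the roots of X^q - X,
  so membership in \<open>F\<close> can be tested by an equation.\<close>

lemma subfield_eq_fixed_points:
  fixes F :: "'a::{field,finite} set"
  assumes F: "is_subfield F" and q: "card F = q"
  shows "F = {x. x ^ q = x}"
proof -
  have "{0, 1} \<subseteq> F" using F by (auto simp: is_subfield_def)
  then have "card {0, 1::'a} \<le> card F" by (intro card_mono) auto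
  then have "q \<ge> 2" using q by simp
  moreover have "F \<subseteq> {x. x ^ q = x}"
    using subfield_power_card[OF F] q by auto
  ultimately show ?thesis using fixed_points_of_power[where ?'a = 'a] q by (intro card_seteq) auto
qed

text \<open>Raising to the power \<open>q\<close> permutes the three factors \<open>x\<close>,
  \<open>x ^ q\<close>, \<open>x ^ (q\<^sup>2)\<close> of the norm cyclically.\<close>

lemma cubic_norm_in_subfield:
  fixes F :: "'a::{field,finite} set"
  assumes "is_subfield F" "card F = q" "CARD('a) = q ^ 3"
  shows "cubic_norm q x \<in> F"
proof -
  have "cubic_norm q x ^ q = x ^ q * (x ^ q) ^ q * x ^ (q ^ 3)"
    by (simp add: cubic_norm_def power_add power_mult_distrib power2_eq_square power3_eq_cube
        mult_ac flip: power_mult)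
  also have "\<dots> = cubic_norm q x"
    using power_card_UNIV[of x] assms(3)
    by (simp add: cubic_norm_def power_add power2_eq_square mult_ac flip: power_mult)
  finally show ?thesis using subfield_eq_fixed_points[OF assms(1,2)] by auto
qed

section \<open>Counting the images of one configuration\<close>

lemma sum_affine:
  fixes A :: "'a::comm_ring_1 set"
  shows "(\<Sum>x\<in>A. l * x + C) = l * \<Sum>A + of_nat (card A) * C"
  by (simp add: sum.distrib sum_distrib_left)

text \<open>
  The maps \<open>(x, u) \<mapsto> (l x + C, m u)\<close> on one side and \<open>(y, v) \<mapsto> (l y - C, N(l) v / m)\<close>
  on the other preserve adjacency. The images of the two sides have a common vertex only if
  \<open>2 C = l (y - x)\<close>, which excludes at most 24 values of \<open>C\<close>. The condition on the sums makes
  the image determine \<open>l\<close> and \<open>C\<close>.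
\<close>

lemma bipartite_copies_from_configuration:
  fixes F A B :: "'a::{field,finite} set" and a b :: "'a \<Rightarrow> 'a"
  assumes F: "is_subfield F" "card F = q" "CARD('a) = q ^ 3" and two: "(2::'a) \<noteq> 0"
    and card: "card A = 4" "card B = 6"
    and a: "\<And>x. x \<in> A \<Longrightarrow> a x \<in> F - {0}" and b: "\<And>y. y \<in> B \<Longrightarrow> b y \<in> F - {0}"
    and adj: "\<And>x y. x \<in> A \<Longrightarrow> y \<in> B \<Longrightarrow> cubic_norm q (x + y) = a x * b y"
    and sums: "3 * \<Sum>A + 2 * \<Sum>B \<noteq> 0"
  shows "(int q ^ 3 - 1) * (int q - 1) * (int q ^ 3 - 24)
           \<le> int (card (bipartite_copies 4 6 (projective_norm_graph4 q F)))"
proof -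
  let ?G = "projective_norm_graph4 q F"
  define U where "U l m C = (\<lambda>x. (l * x + C, m * a x)) ` A" for l m C
  define V where "V l m C = (\<lambda>y. (l * y - C, cubic_norm q l / m * b y)) ` B" for l m C
  define bad where "bad l = (\<lambda>(x, y). l * (y - x) / 2) ` (A \<times> B)" for l
  define I where "I = (SIGMA lm : (UNIV - {0}) \<times> (F - {0}). UNIV - bad (fst lm))"
  define \<Phi> where "\<Phi> = (\<lambda>((l, m), C). biclique (U l m C) (V l m C))"

  have mult_F: "x * y \<in> F" "x / y \<in> F" if "x \<in> F" "y \<in> F" for x y
    using F(1) that by (auto simp: is_subfield_def divide_inverse)
  have card_U: "card (U l m C) = 4" if "l \<noteq> 0" for l m C
    unfolding U_def using that card(1) by (subst card_image) (auto simp: inj_on_def)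
  have card_V: "card (V l m C) = 6" if "l \<noteq> 0" for l m C
    unfolding V_def using that card(2) by (subst card_image) (auto simp: inj_on_def)
  have disj: "l * x + C \<noteq> l * y - C" if "C \<notin> bad l" "x \<in> A" "y \<in> B" for l C x y
  proof
    assume "l * x + C = l * y - C"
    then have "2 * C = l * (y - x)" by (simp add: algebra_simps mult_2)
    then have "C = l * (y - x) / 2" using two by (metis nonzero_mult_div_cancel_left)
    then have "C \<in> bad l" using that(2,3) by (auto simp: bad_def image_def)
    then show False using that(1) by simp
  qed
  have UV: "U l m C \<inter> V l m C = {}" if "C \<notin> bad l" for l m C
    unfolding U_def V_def using disj[OF that] by blast

  have wf: "pair_wf_digraph ?G"
  proof -
    interpret pair_graph ?G by (rule pair_graph_projective_norm_graph4)
    show ?thesis by unfold_locales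
  qed
  have "\<Phi> i \<in> bipartite_copies 4 6 ?G" if "i \<in> I" for i
  proof -
    obtain l m C where i: "i = ((l, m), C)" by (metis surj_pair)
    have l: "l \<noteq> 0" and m: "m \<in> F" "m \<noteq> 0" and C: "C \<notin> bad l"
      using that by (auto simp: I_def i)
    have N: "cubic_norm q l \<in> F" by (rule cubic_norm_in_subfield[OF F])
    have lab_a: "m * a x \<in> F - {0}" if "x \<in> A" for x
      using a[OF that] m mult_F by auto
    have lab_b: "cubic_norm q l / m * b y \<in> F - {0}" if "y \<in> B" for y
      using b[OF that] m l N mult_F by auto
    have edge: "cubic_norm q (l * x + C + (l * y - C)) = m * a x * (cubic_norm q l / m * b y)"
      if "x \<in> A" "y \<in> B" for x y
    proof -
      have "l * x + C + (l * y - C) = l * (x + y)" by (simp add: algebra_simps)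
      then show ?thesis using adj[OF that] m by (simp add: cubic_norm_mult)
    qed
    have edge': "cubic_norm q (l * y - C + (l * x + C)) = cubic_norm q l / m * b y * (m * a x)"
      if "x \<in> A" "y \<in> B" for x y
      using edge[OF that] by (simp add: ac_simps)
    show ?thesis unfolding i \<Phi>_def prod.case
    proof (rule biclique_in_bipartite_copies[OF wf])
      show "U l m C \<union> V l m C \<subseteq> pverts ?G"
        using lab_a lab_b by (auto simp: U_def V_def projective_norm_graph4_def)
      show "U l m C \<times> V l m C \<subseteq> parcs ?G"
        using lab_a lab_b edge disj[OF C] by (auto simp: U_def V_def projective_norm_graph4_def)
      show "V l m C \<times> U l m C \<subseteq> parcs ?G"
        using lab_a lab_b edge' disj[OF C, symmetric]
        by (auto simp: U_def V_def projective_norm_graph4_def)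
    qed (use card_U[OF l] card_V[OF l] UV[OF C] in auto)
  qed
  then have sub: "\<Phi> ` I \<subseteq> bipartite_copies 4 6 ?G" by auto

  have inj: "inj_on \<Phi> I"
  proof (rule inj_onI)
    fix i j assume "i \<in> I" "j \<in> I" and eq: "\<Phi> i = \<Phi> j"
    obtain l m C where i: "i = ((l, m), C)" by (metis surj_pair)
    have l: "l \<noteq> 0" and m: "m \<in> F" "m \<noteq> 0" and C: "C \<notin> bad l"
      using \<open>i \<in> I\<close> by (auto simp: I_def i)
    obtain l' m' C' where j: "j = ((l', m'), C')" by (metis surj_pair)
    have l': "l' \<noteq> 0" and m': "m' \<in> F" "m' \<noteq> 0" and C': "C' \<notin> bad l'"
      using \<open>j \<in> I\<close> by (auto simp: I_def j)
    have "U l m C = U l' m' C' \<and> V l m C = V l' m' C'"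
      by (rule biclique_eq_imp[where m = 4 and n = 6])
        (use eq i j card_U card_V l l' UV[OF C] UV[OF C'] in \<open>auto simp: \<Phi>_def\<close>)
    then have UU: "U l m C = U l' m' C'" and VV: "V l m C = V l' m' C'" by auto
    have sumU: "(\<Sum>z\<in>U l m C. fst z) = l * \<Sum>A + 4 * C" if "l \<noteq> 0" for l m C
    proof -
      have "(\<Sum>z\<in>U l m C. fst z) = (\<Sum>x\<in>A. l * x + C)"
        unfolding U_def by (subst sum.reindex) (use that in \<open>auto simp: inj_on_def\<close>)
      then show ?thesis by (simp add: sum_affine card)
    qed
    have sumV: "(\<Sum>z\<in>V l m C. fst z) = l * \<Sum>B - 6 * C" if "l \<noteq> 0" for l m C
    proof -
      have "(\<Sum>z\<in>V l m C. fst z) = (\<Sum>y\<in>B. l * y + - C)"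
        unfolding V_def by (subst sum.reindex) (use that in \<open>auto simp: inj_on_def\<close>)
      then show ?thesis by (simp only: sum_affine card) simp
    qed
    have e1: "l * \<Sum>A + 4 * C = l' * \<Sum>A + 4 * C'"
      using sumU[OF l] sumU[OF l'] UU by metis
    have e2: "l * \<Sum>B - 6 * C = l' * \<Sum>B - 6 * C'"
      using sumV[OF l] sumV[OF l'] VV by metis
    \<comment> \<open>The weights 3 and 2 eliminate \<open>C\<close> and \<open>C'\<close>, because
      3 * 4 = 2 * 6.\<close>
    have "(l - l') * (3 * \<Sum>A + 2 * \<Sum>B) =
        3 * ((l * \<Sum>A + 4 * C) - (l' * \<Sum>A + 4 * C')) +
        2 * ((l * \<Sum>B - 6 * C) - (l' * \<Sum>B - 6 * C'))"
      by (simp add: algebra_simps)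
    then have ll: "l = l'" using e1 e2 sums by simp
    have "2 * (2 * (C - C')) = 4 * C - 4 * C'" by (simp add: algebra_simps)
    then have "2 * (2 * (C - C')) = 0" using e1 ll by simp
    then have CC: "C = C'" using two by (metis mult_eq_0_iff right_minus_eq)
    obtain x where x: "x \<in> A" using card(1) by fastforce
    then have "(l * x + C, m * a x) \<in> U l' m' C'" using UU by (auto simp: U_def)
    then have "m * a x = m' * a x" using ll CC l by (auto simp: U_def)
    then have "m = m'" using a[OF x] by auto
    then show "i = j" using ll CC i j by simp
  qed

  have bad_card: "card (bad l) \<le> 24" for l
    unfolding bad_def using card_image_le[of "A \<times> B"] card by (simp add: card_cartesian_product)
  have q1: "q \<ge> 1" using F(1,2) by (cases q) (auto simp: is_subfield_def)
  have "card I = (\<Sum>lm\<in>(UNIV - {0}) \<times> (F - {0}). card (UNIV - bad (fst lm)))"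
    unfolding I_def by (subst card_SigmaI) auto
  then have "int (card I) = (\<Sum>lm\<in>(UNIV - {0}) \<times> (F - {0}). int (card (UNIV - bad (fst lm))))"
    by simp
  also have "\<dots> \<ge> (\<Sum>lm\<in>((UNIV::'a set) - {0}) \<times> (F - {0}). int q ^ 3 - 24)"
  proof (rule sum_mono)
    fix lm :: "'a \<times> 'a"
    have "card (UNIV - bad (fst lm)) = q ^ 3 - card (bad (fst lm))"
      using F(3) by (simp add: card_Diff_subset)
    then show "int q ^ 3 - 24 \<le> int (card (UNIV - bad (fst lm)))"
      using bad_card[of "fst lm"] by (simp flip: of_nat_power)
  qed
  also have "(\<Sum>lm\<in>((UNIV::'a set) - {0}) \<times> (F - {0}). int q ^ 3 - 24)
      = (int q ^ 3 - 1) * (int q - 1) * (int q ^ 3 - 24)"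
    using F q1 by (simp add: card_cartesian_product card_Diff_subset is_subfield_def of_nat_diff)
  finally have "(int q ^ 3 - 1) * (int q - 1) * (int q ^ 3 - 24) \<le> int (card I)" .
  also have "card I \<le> card (bipartite_copies 4 6 ?G)"
    by (rule card_inj_on_le[OF inj sub finite_bipartite_copies])
  then have "int (card I) \<le> int (card (bipartite_copies 4 6 ?G))" by simp
  finally show ?thesis .
qed

section \<open>Moving the point at infinity into the field\<close>

text \<open>This supplies the point to be sent to infinity; the inequality is the condition on the
  sums for the transformed points. The two sums are logarithmic derivatives of \<open>f D\<close>
  and \<open>f S\<close>, so equality means a root of the polynomial \<open>P\<close> of degree at
  most 8. Together with the 9 points of \<open>D\<close> and \<open>S\<close>, at most 17 values are
  excluded.\<close>

lemma exists_avoiding_point: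
  fixes D S :: "'a::{field,finite} set"
  assumes card: "card D = 3" "card S = 6" and disj: "D \<inter> S = {}" and three: "(3::'a) \<noteq> 0"
    and big: "CARD('a) > 17"
  shows "\<exists>g. g \<notin> D \<and> g \<notin> S \<and> 3 * (\<Sum>d\<in>D. 1 / (g - d)) \<noteq> 2 * (\<Sum>y\<in>S. 1 / (g - y))"
proof -
  define f where "f T = (\<Prod>t\<in>T. [:-t, 1:])" for T :: "'a set"
  define P where "P = smult 3 (pderiv (f D) * f S) - smult 2 (f D * pderiv (f S))"
  have f_eval: "poly (f T) x = (\<Prod>t\<in>T. x - t)" for T x
    by (simp add: f_def poly_prod)
  have f_deriv: "poly (pderiv (f T)) x = (\<Sum>t\<in>T. \<Prod>s\<in>T-{t}. x - s)" for T x
    by (simp add: f_def pderiv_prod poly_sum poly_prod pderiv_pCons)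
  have f_logderiv: "poly (pderiv (f T)) x = poly (f T) x * (\<Sum>t\<in>T. 1 / (x - t))" if "x \<notin> T" for T x
  proof -
    have "(\<Prod>s\<in>T-{t}. x - s) = (\<Prod>s\<in>T. x - s) * (1 / (x - t))" if "t \<in> T" for t
      using prod.remove[of T t "\<lambda>s. x - s"] that \<open>x \<notin> T\<close> by auto
    then show ?thesis by (simp add: f_deriv f_eval sum_distrib_left)
  qed
  have f_deg: "degree (f T) = card T" for T
    unfolding f_def by (subst degree_prod_eq_sum_degree) auto
  have f_deg': "degree (pderiv (f T)) \<le> card T - 1" for T
    using f_deg by (intro degree_le) (auto simp: coeff_pderiv coeff_eq_0)
  obtain d where d: "d \<in> D" using card(1) by fastforce
  \<comment> \<open>At a point of \<open>D\<close> the second term of \<open>P\<close> vanishes,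
    while the first does not: \<open>d\<close> is a simple root of \<open>f D\<close> and no root of
    \<open>f S\<close>.\<close>
  have "poly P d \<noteq> 0"
  proof -
    have "poly (pderiv (f D)) d = (\<Prod>s\<in>D-{d}. d - s)"
    proof -
      have "(\<Prod>s\<in>D-{t}. d - s) = 0" if "t \<in> D - {d}" for t
        using that d by (intro prod_zero) auto
      then have "(\<Sum>t\<in>D-{d}. \<Prod>s\<in>D-{t}. d - s) = 0" by (intro sum.neutral) blast
      then show ?thesis
        using sum.remove[of D d "\<lambda>t. \<Prod>s\<in>D-{t}. d - s"] d by (simp add: f_deriv)
    qed
    moreover have "poly (f D) d = 0" using d by (auto simp: f_eval)
    moreover have "poly (f S) d \<noteq> 0" using d disj by (auto simp: f_eval)
    ultimately show ?thesis using three by (auto simp: P_def)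
  qed
  then have "P \<noteq> 0" by auto
  have "degree P \<le> 8"
    unfolding P_def
    by (intro degree_diff_le order.trans[OF degree_smult_le] order.trans[OF degree_mult_le])
      (use f_deg[of D] f_deg[of S] f_deg'[of D] f_deg'[of S] card in auto)
  then have roots: "card {x. poly P x = 0} \<le> 8"
    using card_poly_roots_bound[OF \<open>P \<noteq> 0\<close>] by simp
  have "card (D \<union> S \<union> {x. poly P x = 0}) \<le> 17"
    using card_Un_le[of "D \<union> S" "{x. poly P x = 0}"] card_Un_le[of D S] card roots by simp
  then have "D \<union> S \<union> {x. poly P x = 0} \<noteq> UNIV" using big by auto
  then obtain g where g: "g \<notin> D" "g \<notin> S" "poly P g \<noteq> 0" by auto
  have "poly P g = poly (f D) g * poly (f S) g *
      (3 * (\<Sum>d\<in>D. 1 / (g - d)) - 2 * (\<Sum>y\<in>S. 1 / (g - y)))"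
    by (simp add: P_def f_logderiv g algebra_simps)
  then show ?thesis using g by auto
qed

text \<open>
  The set \<open>D\<close> together with the point at infinity plays the role of the four vertices. A
  homography sending a suitable \<open>g\<close> to infinity makes all ten points finite: it changes
  \<open>N(y - d)\<close> only by factors depending on \<open>y\<close> alone or on \<open>d\<close> alone.
\<close>

lemma bipartite_copies_from_norm_system:
  fixes F D S :: "'a::{field,finite} set" and c :: "'a \<Rightarrow> 'a"
  assumes F: "is_subfield F" "card F = q" "CARD('a) = q ^ 3" and q: "q \<ge> 5"
    and two: "(2::'a) \<noteq> 0" and three: "(3::'a) \<noteq> 0"
    and card: "card D = 3" "card S = 6"
    and c: "\<And>d. d \<in> D \<Longrightarrow> c d \<noteq> 0"
    and norm: "\<And>d y. d \<in> D \<Longrightarrow> y \<in> S \<Longrightarrow> cubic_norm q (y - d) = c d"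
  shows "(int q ^ 3 - 1) * (int q - 1) * (int q ^ 3 - 24)
           \<le> int (card (bipartite_copies 4 6 (projective_norm_graph4 q F)))"
proof -
  let ?N = "cubic_norm q :: 'a \<Rightarrow> 'a"
  have N_F: "?N x \<in> F" for x by (rule cubic_norm_in_subfield[OF F])
  obtain y0 where y0: "y0 \<in> S" using card(2) by fastforce
  have c_F: "c d \<in> F" if "d \<in> D" for d
    using norm[OF that y0] N_F by metis
  have disj: "D \<inter> S = {}"
  proof -
    have "d \<notin> S" if "d \<in> D" for d
      using norm[OF that, of d] c[OF that] by auto
    then show ?thesis by auto
  qed
  have "5 ^ 3 \<le> q ^ 3" using q by (rule power_mono) simp
  then obtain g where g: "g \<notin> D" "g \<notin> S"
    and gs: "3 * (\<Sum>d\<in>D. 1 / (g - d)) \<noteq> 2 * (\<Sum>y\<in>S. 1 / (g - y))"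
    using exists_avoiding_point[OF card disj three] F(3) by auto
  define A where "A = insert 0 ((\<lambda>d. 1 / (d - g)) ` D)"
  define B where "B = (\<lambda>y. - 1 / (y - g)) ` S"
  \<comment> \<open>The element 0 of \<open>A\<close> is the image of infinity. For every other
    \<open>x\<close> in \<open>A\<close>, \<open>g + 1 / x\<close> recovers the point
    \<open>d\<close> it comes from.\<close>
  define a where "a x = (if x = 0 then 1 else - c (g + 1 / x) * ?N x)" for x
  have injD: "inj_on (\<lambda>d. 1 / (d - g)) D" and injS: "inj_on (\<lambda>y. - 1 / (y - g)) S"
    using g by (auto simp: inj_on_def field_simps)
  have ne0: "0 \<notin> (\<lambda>d. 1 / (d - g)) ` D" using g by auto
  have cardA: "card A = 4" using ne0 by (simp add: A_def card_image[OF injD] card)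
  have cardB: "card B = 6" using card_image[OF injS] by (simp add: B_def card)
  have sumA: "\<Sum>A = (\<Sum>d\<in>D. 1 / (d - g))"
    using ne0 by (simp add: A_def sum.reindex[OF injD])
  have sumB: "\<Sum>B = (\<Sum>y\<in>S. - 1 / (y - g))"
    using sum.reindex[OF injS, of "\<lambda>x. x"] by (simp add: B_def)
  have neg: "1 / (g - x) = - (1 / (x - g))" for x
    using minus_divide_right[of 1 "x - g"] by simp
  have sums: "3 * \<Sum>A + 2 * \<Sum>B \<noteq> 0"
    using gs unfolding sumA sumB neg by (simp add: sum_negf)
  have F_closed: "x * y \<in> F" "- x \<in> F" if "x \<in> F" "y \<in> F" for x y
    using F(1) that by (auto simp: is_subfield_def)
  show ?thesis
  proof (rule bipartite_copies_from_configuration[OF F two cardA cardB, of a ?N])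
    fix x assume "x \<in> A"
    then consider "x = 0" | d where "d \<in> D" "x = 1 / (d - g)" by (auto simp: A_def)
    then show "a x \<in> F - {0}"
    proof cases
      case 1
      then show ?thesis using F(1) by (auto simp: a_def is_subfield_def)
    next
      case 2
      then have "x \<noteq> 0" using g by auto
      then show ?thesis using 2 c[OF 2(1)] c_F[OF 2(1)] N_F F_closed by (auto simp: a_def)
    qed
  next
    fix y assume "y \<in> B"
    then show "?N y \<in> F - {0}" using N_F g by (auto simp: B_def)
  next
    fix x y assume x: "x \<in> A" and "y \<in> B"
    then obtain z where z: "z \<in> S" "y = - 1 / (z - g)" by (auto simp: B_def)
    from x consider "x = 0" | d where "d \<in> D" "x = 1 / (d - g)" by (auto simp: A_def)
    then show "?N (x + y) = a x * ?N y"
    proof cases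
      case 1
      then show ?thesis by (simp add: a_def)
    next
      case 2
      have nz: "d - g \<noteq> 0" "z - g \<noteq> 0" using 2 z g by auto
      have "x + y = (z - d) * (x * (- y))" unfolding 2 z(2) using nz by (simp add: field_simps)
      then have "?N (x + y) = c d * (?N x * - ?N y)"
        using norm[OF 2(1) z(1)] by (simp only: cubic_norm_mult cubic_norm_minus)
      then show ?thesis using 2 nz by (simp add: a_def)
    qed
  qed (rule sums)
qed

section \<open>Parameters whose image under a homography is not a cube\<close>

text \<open>X^n - c splits into linear factors, and a double root would also be a root of the
  derivative n X^(n-1), hence 0, which is impossible as \<open>c\<close> is nonzero.\<close>

lemma card_nth_roots:
  fixes c :: "'a::alg_closed_field"
  assumes n: "of_nat n \<noteq> (0 :: 'a)" and c: "c \<noteq> 0"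
  shows "card {x. x ^ n = c} = n"
proof -
  define P where "P = monom 1 n - [:c:]"
  have "n > 0" using n by (cases n) auto
  have eval: "poly P x = x ^ n - c" for x by (simp add: P_def poly_monom)
  have eval': "poly (pderiv P) x = of_nat n * x ^ (n - 1)" for x
    by (simp add: P_def pderiv_diff pderiv_monom poly_monom pderiv_pCons)
  have lc: "coeff P n = 1" using \<open>n > 0\<close> by (simp add: P_def coeff_pCons split: nat.splits)
  then have "P \<noteq> 0" by auto
  have "degree P = n"
  proof (rule antisym)
    show "degree P \<le> n"
      unfolding P_def by (intro degree_diff_le) (auto intro: degree_monom_le)
    show "n \<le> degree P" using lc by (intro le_degree) auto
  qed
  obtain A where A: "size A = degree P" "P = smult (lead_coeff P) (\<Prod>x\<in>#A. [:-x, 1:])"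
    using alg_closed_imp_factorization[OF \<open>P \<noteq> 0\<close>] by blast
  have P_A: "P = (\<Prod>x\<in>#A. [:-x, 1:])" using A(2) lc \<open>degree P = n\<close> by simp
  have root: "poly P x = 0 \<longleftrightarrow> x \<in># A" for x
    unfolding P_A by (auto simp: poly_prod_mset prod_mset_zero_iff)
  have "count A x \<le> 1" for x
  proof (rule ccontr)
    assume "\<not> count A x \<le> 1"
    then obtain B where B: "A = add_mset x (add_mset x B)"
      by (metis One_nat_def count_add_mset count_eq_zero_iff le_SucI less_imp_le_nat
          mset_add not_less nat_le_linear zero_le leI less_one)
    define c R where "c = [:-x, 1:]" and "R = (\<Prod>x\<in>#B. [:-x, 1:])"
    have "P = c * (c * R)" unfolding P_A B c_def R_def by (simp only: image_mset_add_mset prod_mset.add_mset)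
    moreover have "poly c x = 0" by (simp add: c_def)
    ultimately have "poly P x = 0" "poly (pderiv P) x = 0"
      by (simp_all add: pderiv_mult)
    then show False using n c \<open>n > 0\<close> by (auto simp: eval eval')
  qed
  then have "A = mset_set (set_mset A)"
    by (intro multiset_eqI) (metis One_nat_def count_mset_set(1,3) finite_set_mset le_antisym
        count_greater_eq_one_iff not_in_iff)
  then have "size A = card (set_mset A)" by (metis size_mset_set)
  moreover have "set_mset A = {x. x ^ n = c}" using root eval by auto
  ultimately show ?thesis using A(1) \<open>degree P = n\<close> by simp
qed

text \<open>As \<open>n\<close> is even, the sign of the coefficient depends only on the parity of
  \<open>j\<close>.\<close>

lemma coeff_linear_power_diff:
  fixes e :: "'a::comm_ring_1"
  assumes "even n" "j \<le> n"
  shows "coeff ([:-1, 1:] ^ n - smult e ([:1, 1:] ^ n)) j = ((- 1) ^ j - e) * of_nat (n choose j)"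
  using assms by (simp add: coeff_linear_poly_power minus_one_power_iff algebra_simps)

text \<open>Free of division, so that the equations can be mapped into a field of any
  characteristic.\<close>

lemma binomial_3_5:
  "6 * (n choose 3) = n * (n - 1) * (n - 2)"
  "120 * (n choose 5) = n * (n - 1) * (n - 2) * (n - 3) * (n - 4)"
proof -
  note absorb = times_binomial_minus1_eq
  have 2: "2 * (n choose 2) = n * (n - 1)" for n :: nat
    by (subst absorb) auto
  have 3: "6 * (n choose 3) = n * (n - 1) * (n - 2)" for n :: nat
  proof -
    have "6 * (n choose 3) = 2 * (3 * (n choose 3))" by simp
    also have "\<dots> = n * (2 * ((n - 1) choose 2))" by (subst absorb) auto
    finally show ?thesis unfolding 2 by (simp add: mult.assoc numeral_2_eq_2)
  qed
  have 4: "24 * (n choose 4) = n * (n - 1) * (n - 2) * (n - 3)" for n :: nat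
  proof -
    have "24 * (n choose 4) = 6 * (4 * (n choose 4))" by simp
    also have "\<dots> = n * (6 * ((n - 1) choose 3))" by (subst absorb) auto
    finally show ?thesis unfolding 3 by (simp add: mult.assoc eval_nat_numeral)
  qed
  have 5: "120 * (n choose 5) = n * (n - 1) * (n - 2) * (n - 3) * (n - 4)" for n :: nat
  proof -
    have "120 * (n choose 5) = 24 * (5 * (n choose 5))" by simp
    also have "\<dots> = n * (24 * ((n - 1) choose 4))" by (subst absorb) auto
    finally show ?thesis unfolding 4 by (simp add: mult.assoc eval_nat_numeral)
  qed
  show "6 * (n choose 3) = n * (n - 1) * (n - 2)"
    "120 * (n choose 5) = n * (n - 1) * (n - 2) * (n - 3) * (n - 4)"
    using 3 5 by auto
qed

text \<open>
  Were the conclusion false, the polynomials \<open>(X\<^sup>2 - 1) ((X - 1)\<^sup>n - (X + 1)\<^sup>n)\<close> and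
  \<open>- 2 n X (X\<^sup>n - 1)\<close>, which agree in degrees \<open>\<ge> n\<close>, would agree on the \<open>n\<close>-th roots of unity
  and hence be equal.
\<close>

lemma exists_homography_not_root_of_unity:
  assumes n: "even n" "n \<ge> 6" and n3: "of_nat (3 * n + 1) = (0 :: 'a::alg_closed_field)"
    and two: "(2::'a) \<noteq> 0"
  shows "\<exists>a::'a. a ^ n = 1 \<and> a\<^sup>2 \<noteq> 1 \<and> ((a - 1) / (a + 1)) ^ n \<noteq> 1"
proof (rule ccontr)
  assume neg: "\<not> ?thesis"
  define N where "N = (of_nat n :: 'a)"
  have N3: "3 * N = - 1" using n3 by (simp add: N_def eq_neg_iff_add_eq_0 add.commute)
  then have N0: "N \<noteq> 0" by auto
  define P where "P = [:-1, 1:] ^ n - smult 1 ([:1, 1:] ^ n :: 'a poly)"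
  define Q where "Q = [:-1, 0, 1:] * P + smult (2 * N) (monom 1 (n + 1) - monom 1 1)"
  have P: "coeff P j = ((- 1) ^ j - 1) * of_nat (n choose j)" for j
  proof (cases "j \<le> n")
    case True
    then show ?thesis unfolding P_def by (rule coeff_linear_power_diff[OF n(1)])
  next
    case False
    have "degree P \<le> n" unfolding P_def
      by (intro degree_diff_le order.trans[OF degree_smult_le] order.trans[OF degree_power_le]) auto
    then show ?thesis using False by (simp add: coeff_eq_0 binomial_eq_0)
  qed
  have Q: "coeff Q (j + 2) = coeff P j - coeff P (j + 2) + (if j + 2 = n + 1 then 2 * N else 0)" for j
    by (simp add: Q_def coeff_pCons numeral_2_eq_2)
  \<comment> \<open>The coefficients of \<open>P\<close> vanish in even degrees and above
    \<open>n\<close>, so only degree \<open>n + 1\<close> is critical: there \<open>P\<close>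
    contributes - 2 n, which the added monomial cancels.\<close>
  have high: "coeff Q j = 0" if "j \<ge> n" for j
  proof -
    define i where "i = j - 2"
    have i: "j = i + 2" using that n by (simp add: i_def)
    consider "j = n" | "j = n + 1" | "j \<ge> n + 2" using \<open>j \<ge> n\<close> by linarith
    then show ?thesis
    proof cases
      case 1
      then have "even i" "even (i + 2)" using n i by auto
      then show ?thesis using 1 unfolding i Q using n(1) by (simp add: P minus_one_power_iff)
    next
      case 2
      then have "i = n - 1" "odd i" using n i by auto
      moreover have "n choose (n - 1) = n" using n by (subst binomial_symmetric) auto
      ultimately show ?thesis using 2 unfolding i Q by (simp add: P N_def binomial_eq_0)
    next
      case 3
      show ?thesis
      proof (cases "i = n")
        case True
        then show ?thesis using n 3 unfolding i Q by (simp add: P binomial_eq_0 minus_one_power_iff)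
      next
        case False
        then have "i > n" using 3 i by auto
        then show ?thesis using 3 unfolding i Q by (simp add: P binomial_eq_0 minus_one_power_iff)
      qed
    qed
  qed
  have "Q = 0"
  proof (rule ccontr)
    assume "Q \<noteq> 0"
    have "degree Q < n" using high n by (intro degree_lessI) auto
    have "poly Q a = 0" if "a ^ n = 1" for a
    proof -
      have "a\<^sup>2 = 1 \<or> (a - 1) ^ n = (a + 1) ^ n"
      proof (cases "a + 1 = 0")
        case True
        then have "a = - 1" by (simp add: eq_neg_iff_add_eq_0)
        then show ?thesis by simp
      next
        case False
        then show ?thesis using neg that by (auto simp: power_divide)
      qed
      then have "(a\<^sup>2 - 1) * ((a - 1) ^ n - (a + 1) ^ n) = 0" by auto
      moreover have "poly Q a = (a\<^sup>2 - 1) * ((a - 1) ^ n - (a + 1) ^ n) + 2 * N * (a * a ^ n - a)"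
        by (simp add: Q_def P_def poly_monom power2_eq_square algebra_simps)
      ultimately show ?thesis using that by simp
    qed
    then have "{a. a ^ n = 1} \<subseteq> {a. poly Q a = 0}" by auto
    then have "card {a::'a. a ^ n = 1} \<le> card {a. poly Q a = 0}"
      by (intro card_mono poly_roots_finite \<open>Q \<noteq> 0\<close>)
    also have "\<dots> \<le> degree Q" by (rule card_poly_roots_bound[OF \<open>Q \<noteq> 0\<close>])
    finally show False
      using card_nth_roots[of n "1::'a"] N0 \<open>degree Q < n\<close> by (simp add: N_def)
  qed
  have sym: "n choose (n - k) = n choose k" if "k \<le> n" for k
    using that by (metis binomial_symmetric)
  define m where "m = n - 6"
  have m: "n = m + 6" using n(2) by (simp add: m_def)
  have "even m" using m n by simp
  have e: "m + 3 + 2 = m + 5" "m + 1 + 2 = m + 3" by simp_all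
  have d: "n - 1 = m + 5" "n - 3 = m + 3" "n - 5 = m + 1" using m by simp_all
  \<comment> \<open>The coefficients of \<open>Q\<close> in degrees n - 1 and n - 3 are zero. By the
    symmetry of binomial coefficients, n choose 1, 3 and 5 therefore have the same image in the
    field.\<close>
  have "coeff P (m + 3) = coeff P (m + 5)"
    using Q[of "m + 3"] unfolding e \<open>Q = 0\<close> by (simp add: m)
  moreover have "coeff P (m + 1) = coeff P (m + 3)"
    using Q[of "m + 1"] unfolding e \<open>Q = 0\<close> by (simp add: m)
  moreover have "n choose (m + 5) = n choose 1" by (rule sym[of 1, unfolded d]) (use n in simp)
  moreover have "n choose (m + 3) = n choose 3" by (rule sym[of 3, unfolded d]) (use n in simp)
  moreover have "n choose (m + 1) = n choose 5" by (rule sym[of 5, unfolded d]) (use n in simp)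
  ultimately have "- 2 * of_nat (n choose 3) = - 2 * N" "- 2 * of_nat (n choose 5) = - 2 * (of_nat (n choose 3) :: 'a)"
    using \<open>even m\<close> by (simp_all add: P N_def)
  then have b: "of_nat (n choose 3) = N" "of_nat (n choose 5) = N"
    using two by auto
  have "of_nat (6 * (n choose 3)) = N * (N - 1) * (N - 2)"
    unfolding binomial_3_5 using n by (simp add: N_def of_nat_diff)
  then have "6 * N = N * (N - 1) * (N - 2)" using b by simp
  then have 3: "(N - 1) * (N - 2) = 6" using N0 by (simp add: mult.assoc)
  have "of_nat (120 * (n choose 5)) = N * (N - 1) * (N - 2) * (N - 3) * (N - 4)"
    unfolding binomial_3_5 using n by (simp add: N_def of_nat_diff)
  then have "120 * N = N * (N - 1) * (N - 2) * (N - 3) * (N - 4)" using b by simp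
  then have 5: "(N - 1) * (N - 2) * (N - 3) * (N - 4) = 120" using N0 by (simp add: mult.assoc)
  \<comment> \<open>Substituting 3 N = - 1 turns the two equations for \<open>N\<close> into
    numerical ones, 26 = 0 and 6080 = 0, and the greatest common divisor of these numbers is
    2.\<close>
  have "9 * ((N - 1) * (N - 2)) = (3 * N - 3) * (3 * N - 6)" by (simp add: algebra_simps)
  then have "54 = (28::'a)" unfolding 3 N3 by simp
  moreover have "(26::'a) = 54 - 28" by simp
  ultimately have 26: "26 = (0::'a)" by (simp only: diff_self)
  have "81 * ((N - 1) * (N - 2) * (N - 3) * (N - 4)) = (3 * N - 3) * (3 * N - 6) * (3 * N - 9) * (3 * N - 12)"
    by (simp add: algebra_simps)
  then have "9720 = (3640::'a)" unfolding 5 N3 by simp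
  moreover have "(6080::'a) = 9720 - 3640" by simp
  ultimately have 6080: "6080 = (0::'a)" by (simp only: diff_self)
  have "(2::'a) = 6 * 6080 - 1403 * 26" by simp
  also have "\<dots> = 0" by (simp only: 26 6080 mult_zero_right diff_self)
  finally show False using two by simp
qed

text \<open>Otherwise (X - 1)^n + (X + 1)^n - 2 (X^n + 1), of degree below \<open>n\<close>, would
  vanish at all \<open>n\<close> solutions of a^n = - 1 and so be zero. Its coefficient at X^2 is n
  (n - 1), which forces n = 1 in the field, against 3 n = 1.\<close>

lemma exists_homography_not_root_of_minus_one:
  assumes n: "even n" "n \<ge> 4" and n3: "of_nat (3 * n) = (1 :: 'a::alg_closed_field)"
    and two: "(2::'a) \<noteq> 0"
  shows "\<exists>a::'a. a ^ n = - 1 \<and> a\<^sup>2 \<noteq> 1 \<and> ((a - 1) / (a + 1)) ^ n \<noteq> - 1"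
proof (rule ccontr)
  assume neg: "\<not> ?thesis"
  define N where "N = (of_nat n :: 'a)"
  have N3: "3 * N = 1" using n3 by (simp add: N_def)
  then have N0: "N \<noteq> 0" by auto
  define P where "P = [:-1, 1:] ^ n - smult (- 1) ([:1, 1:] ^ n :: 'a poly)"
  define Q where "Q = P - smult 2 (monom 1 n + 1)"
  have P: "coeff P j = ((- 1) ^ j + 1) * of_nat (n choose j)" if "j \<le> n" for j
    using coeff_linear_power_diff[OF n(1) that, of "- 1 :: 'a"] by (simp add: P_def)
  have "degree Q \<le> n" unfolding Q_def P_def
    by (intro degree_diff_le order.trans[OF degree_smult_le] order.trans[OF degree_power_le]
        degree_add_le degree_monom_le) auto
  then have high: "coeff Q j = 0" if "j \<ge> n" for j
  proof (cases "j = n")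
    case True
    then show ?thesis using n P[of n] by (simp add: Q_def)
  next
    case False
    then show ?thesis using that \<open>degree Q \<le> n\<close> by (simp add: coeff_eq_0)
  qed
  have "Q = 0"
  proof (rule ccontr)
    assume "Q \<noteq> 0"
    have "degree Q < n" using high n by (intro degree_lessI) auto
    have "poly Q a = 0" if a: "a ^ n = - 1" for a
    proof -
      have "a\<^sup>2 \<noteq> 1"
      proof
        assume "a\<^sup>2 = 1"
        then have "a ^ n = 1" using n(1) by (metis evenE power_mult power_one)
        then show False using a two by (metis eq_neg_iff_add_eq_0 one_add_one)
      qed
      then have "a + 1 \<noteq> 0" by (metis eq_neg_iff_add_eq_0 power2_minus power_one)
      then have "(a - 1) ^ n = - ((a + 1) ^ n)"
        using neg a \<open>a\<^sup>2 \<noteq> 1\<close> by (auto simp: power_divide field_simps)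
      then show ?thesis using a by (simp add: Q_def P_def poly_monom algebra_simps)
    qed
    then have "{a. a ^ n = - 1} \<subseteq> {a. poly Q a = 0}" by auto
    then have "card {a::'a. a ^ n = - 1} \<le> card {a. poly Q a = 0}"
      by (intro card_mono poly_roots_finite \<open>Q \<noteq> 0\<close>)
    also have "\<dots> \<le> degree Q" by (rule card_poly_roots_bound[OF \<open>Q \<noteq> 0\<close>])
    finally show False
      using card_nth_roots[of n "-1::'a"] N0 \<open>degree Q < n\<close> by (simp add: N_def)
  qed
  then have "coeff Q 2 = 0" by simp
  then have "2 * of_nat (n choose 2) = (0::'a)"
    using P[of 2] n by (simp add: Q_def)
  moreover have "2 * (n choose 2) = n * (n - 1)" by (subst times_binomial_minus1_eq) auto
  then have "2 * of_nat (n choose 2) = N * (N - 1)"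
    using n by (metis N_def of_nat_mult of_nat_numeral of_nat_diff of_nat_1 le_trans one_le_numeral)
  ultimately have "N = 1" using N0 by simp
  then have "(3::'a) - 1 = 0" using N3 by simp
  then show False using two by simp
qed

section \<open>The generic configuration\<close>

text \<open>The classical factorization of x^3 + y^3 + z^3 - 3 x y z; the three factors will be the
  conjugates of \<open>s + u + v\<close>.\<close>

lemma norm_form_cube_roots_of_unity:
  fixes \<omega> :: "'a::field"
  assumes "\<omega>\<^sup>2 + \<omega> + 1 = 0"
  shows "(s + u + v) * (s + \<omega> * u + \<omega>\<^sup>2 * v) * (s + \<omega>\<^sup>2 * u + \<omega> * v) = s ^ 3 - 3 * s * (u * v) + u ^ 3 + v ^ 3"
  using assms by Groebner_Basis.algebra

text \<open>Dividing a coincidence by \<open>x - y\<close> leaves u = - (x + y) v, and - (x + y) is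
  the third cube root of unity, so u^3 = v^3.\<close>

lemma inj_on_cube_roots_of_unity:
  fixes u v :: "'a::field"
  assumes uv: "u ^ 3 \<noteq> v ^ 3"
  shows "inj_on (\<lambda>z. s + z * u + z\<^sup>2 * v) {z. z ^ 3 = 1}"
proof (rule inj_onI, rule ccontr)
  fix x y :: 'a
  assume "x \<in> {z. z ^ 3 = 1}" "y \<in> {z. z ^ 3 = 1}" and "x \<noteq> y"
    and eq: "s + x * u + x\<^sup>2 * v = s + y * u + y\<^sup>2 * v"
  then have xy: "x ^ 3 = 1" "y ^ 3 = 1" by auto
  have "(x - y) * (x\<^sup>2 + x * y + y\<^sup>2) = 0" using xy by Groebner_Basis.algebra
  then have *: "x\<^sup>2 + x * y + y\<^sup>2 = 0" using \<open>x \<noteq> y\<close> by simp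
  have "(x - y) * (u + (x + y) * v) = 0" using eq by Groebner_Basis.algebra
  then have "u = - ((x + y) * v)" using \<open>x \<noteq> y\<close> by (simp add: eq_neg_iff_add_eq_0)
  moreover have "(x + y) ^ 3 = - 1" using * xy by Groebner_Basis.algebra
  ultimately have "u ^ 3 = v ^ 3" by Groebner_Basis.algebra
  then show False using uv by simp
qed

text \<open>What is left of the norm equation for the conjugate points once \<open>m\<close> and
  \<open>w\<close> are eliminated: an identity of Laurent polynomials in \<theta>.\<close>

lemma norm_identity_one_variable:
  fixes \<theta> \<theta>' :: "'a::field"
  assumes "\<theta> * \<theta>' = 1"
  shows "8 + 6 * (\<theta> - \<theta>') * ((1 - \<theta> ^ 6) * \<theta>' ^ 3)
      + (\<theta> - 1) ^ 3 * ((\<theta> ^ 3 - 1) * (\<theta> ^ 3 + 1)\<^sup>2 * \<theta>' ^ 6)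
      + (\<theta>' + 1) ^ 3 * ((\<theta> ^ 3 - 1)\<^sup>2 * (\<theta> ^ 3 + 1) * \<theta>' ^ 3) = 2 * (\<theta> ^ 3 + \<theta>' ^ 3)\<^sup>2"
proof -
  have "\<theta> \<noteq> 0" using assms by auto
  then have \<theta>': "\<theta>' = 1 / \<theta>" using assms by (simp add: field_simps)
  show ?thesis unfolding \<theta>' using \<open>\<theta> \<noteq> 0\<close>
    by (simp add: field_simps) (simp add: algebra_simps eval_nat_numeral)
qed

text \<open>The two terms of \<open>x\<close> have product \<open>m * w\<close>, so Cardano's
  formula evaluates \<open>x ^ 3 - 3 * x * (m * w)\<close> as the sum of their cubes, where the
  choice of \<open>z\<close> disappears.\<close>

lemma norm_rational_points:
  fixes \<omega> :: "'a::field"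
  assumes \<omega>: "\<omega>\<^sup>2 + \<omega> + 1 = 0" and r: "r * r' = 1" and o: "z ^ 3 = 1" and o': "z' ^ 3 = 1"
    and M: "m * w = (1 - r ^ 6) * r' ^ 3"
    and m3: "m ^ 3 = (r ^ 3 - 1) * (r ^ 3 + 1)\<^sup>2 * r' ^ 6"
    and w3: "w ^ 3 = - ((r ^ 3 - 1)\<^sup>2 * (r ^ 3 + 1) * r' ^ 3)"
    and x: "x = z * ((r ^ 3 + 1) * r') - z\<^sup>2 * ((r ^ 3 - 1) * r'\<^sup>2)"
  shows "(x - z' * m - z'\<^sup>2 * w) * (x - \<omega> * z' * m - \<omega>\<^sup>2 * z'\<^sup>2 * w) * (x - \<omega>\<^sup>2 * z' * m - \<omega> * z'\<^sup>2 * w)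
    = 2 * (r ^ 3 + r' ^ 3)\<^sup>2"
proof -
  let ?u = "z * ((r ^ 3 + 1) * r')" and ?v = "- (z\<^sup>2 * ((r ^ 3 - 1) * r'\<^sup>2))"
  have "(x - z' * m - z'\<^sup>2 * w) * (x - \<omega> * z' * m - \<omega>\<^sup>2 * z'\<^sup>2 * w) * (x - \<omega>\<^sup>2 * z' * m - \<omega> * z'\<^sup>2 * w)
    = x ^ 3 - 3 * x * ((- (z' * m)) * (- (z'\<^sup>2 * w))) + (- (z' * m)) ^ 3 + (- (z'\<^sup>2 * w)) ^ 3"
    using norm_form_cube_roots_of_unity[OF \<omega>, of x "- (z' * m)" "- (z'\<^sup>2 * w)"]
    by (simp add: algebra_simps)
  also have "(- (z' * m)) * (- (z'\<^sup>2 * w)) = m * w" using o' by Groebner_Basis.algebra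
  also have "(- (z' * m)) ^ 3 = - (m ^ 3)" using o' by Groebner_Basis.algebra
  also have "(- (z'\<^sup>2 * w)) ^ 3 = - (w ^ 3)" using o' by Groebner_Basis.algebra
  also have "x ^ 3 - 3 * x * (m * w) = ?u ^ 3 + ?v ^ 3"
  proof -
    have x: "x = ?u + ?v" using x by simp
    have "?u * ?v = - (z ^ 3 * ((r ^ 6 - 1) * r' ^ 3))" by Groebner_Basis.algebra
    then have uv: "?u * ?v = m * w" unfolding M o by (simp add: algebra_simps)
    show ?thesis unfolding uv[symmetric] x by Groebner_Basis.algebra
  qed
  also have "?u ^ 3 = (r ^ 3 + 1) ^ 3 * r' ^ 3" using o by Groebner_Basis.algebra
  also have "?v ^ 3 = - ((r ^ 3 - 1) ^ 3 * r' ^ 6)" using o by Groebner_Basis.algebra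
  also have "(r ^ 3 + 1) ^ 3 * r' ^ 3 + - ((r ^ 3 - 1) ^ 3 * r' ^ 6) + - (m ^ 3) + - (w ^ 3) = 2 * (r ^ 3 + r' ^ 3)\<^sup>2"
  proof -
    define a b where "a = r ^ 3" and "b = r' ^ 3"
    have ab: "a * b = 1" using r unfolding a_def b_def by Groebner_Basis.algebra
    have b2: "r' ^ 6 = b\<^sup>2" by (simp add: b_def flip: power_mult)
    have "(a + 1) ^ 3 * b - (a - 1) ^ 3 * b\<^sup>2 - (a - 1) * (a + 1)\<^sup>2 * b\<^sup>2 + (a - 1)\<^sup>2 * (a + 1) * b
       = 2 * (a + b)\<^sup>2"
      using ab by Groebner_Basis.algebra
    then show ?thesis unfolding m3 w3 b2 a_def[symmetric] b_def[symmetric] by simp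
  qed
  finally show ?thesis .
qed

text \<open>\<open>u\<close> and \<open>v\<close> are the Cardano coordinates of the difference of
  two conjugate points. Passing to \<theta> absorbs the cube root of unity \<open>z\<close> without
  changing \<open>r ^ 3\<close>.\<close>

lemma norm_conjugate_points:
  fixes \<omega> :: "'a::field"
  assumes \<omega>: "\<omega>\<^sup>2 + \<omega> + 1 = 0" and r: "r * r' = 1" and o: "z ^ 3 = 1"
    and M: "m * w = (1 - r ^ 6) * r' ^ 3"
    and m3: "m ^ 3 = (r ^ 3 - 1) * (r ^ 3 + 1)\<^sup>2 * r' ^ 6"
    and w3: "w ^ 3 = - ((r ^ 3 - 1)\<^sup>2 * (r ^ 3 + 1) * r' ^ 3)"
    and u: "u = (r - z) * m" and v: "v = - ((r' + z\<^sup>2) * w)"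
  shows "(2 + u + v) * (2 + \<omega> * u + \<omega>\<^sup>2 * v) * (2 + \<omega>\<^sup>2 * u + \<omega> * v) = 2 * (r ^ 3 + r' ^ 3)\<^sup>2"
proof -
  define \<theta> \<theta>' where "\<theta> = z\<^sup>2 * r" and "\<theta>' = z * r'"
  have \<theta>: "\<theta> * \<theta>' = 1" unfolding \<theta>_def \<theta>'_def using r o by Groebner_Basis.algebra
  have \<theta>3: "r ^ 3 = \<theta> ^ 3" "r' ^ 3 = \<theta>' ^ 3" unfolding \<theta>_def \<theta>'_def using o by Groebner_Basis.algebra+
  have \<theta>6: "r ^ 6 = \<theta> ^ 6" "r' ^ 6 = \<theta>' ^ 6"
    using \<theta>3 power_mult[of r 3 2] power_mult[of \<theta> 3 2] power_mult[of r' 3 2] power_mult[of \<theta>' 3 2]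
    by simp_all
  have "u = z * ((\<theta> - 1) * m)" "v = - (z\<^sup>2 * ((\<theta>' + 1) * w))"
    unfolding u v \<theta>_def \<theta>'_def using o by Groebner_Basis.algebra+
  then have u3: "u ^ 3 = (\<theta> - 1) ^ 3 * m ^ 3" and v3: "v ^ 3 = - ((\<theta>' + 1) ^ 3 * w ^ 3)"
    and "u * v = - (((\<theta> - 1) * (\<theta>' + 1)) * (m * w))"
    using o by Groebner_Basis.algebra+
  moreover have "(\<theta> - 1) * (\<theta>' + 1) = \<theta> - \<theta>'" using \<theta> by (simp add: algebra_simps)
  ultimately have uv: "u * v = - ((\<theta> - \<theta>') * (m * w))" by simp
  have "(2 + u + v) * (2 + \<omega> * u + \<omega>\<^sup>2 * v) * (2 + \<omega>\<^sup>2 * u + \<omega> * v) = 2 ^ 3 - 3 * 2 * (u * v) + u ^ 3 + v ^ 3"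
    by (rule norm_form_cube_roots_of_unity[OF \<omega>])
  also have "\<dots> = 8 + 6 * (\<theta> - \<theta>') * (m * w) + (\<theta> - 1) ^ 3 * m ^ 3 - (\<theta>' + 1) ^ 3 * w ^ 3"
    unfolding uv u3 v3 by simp
  also have "\<dots> = 2 * (\<theta> ^ 3 + \<theta>' ^ 3)\<^sup>2"
    using norm_identity_one_variable[OF \<theta>] unfolding M m3 w3 \<theta>3 \<theta>6 by (simp add: algebra_simps)
  finally show ?thesis unfolding \<theta>3 .
qed

section \<open>Frobenius orbits built from the identities\<close>

lemma cubic_norm_altdef: "cubic_norm q x = x * x ^ q * (x ^ q) ^ q"
  by (simp add: cubic_norm_def power_add power2_eq_square flip: power_mult)

text \<open>The condition on \<open>x ^ (q ^ 3)\<close> confines the points to the field with q^3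
  elements, so that they can be constructed inside an algebraic closure.\<close>

definition norm_configuration :: "nat \<Rightarrow> 'a::field set \<Rightarrow> 'a set \<Rightarrow> bool" where
  "norm_configuration q D S \<longleftrightarrow> card D = 3 \<and> card S = 6 \<and> (\<forall>x\<in>D \<union> S. x ^ (q ^ 3) = x) \<and>
     (\<forall>d\<in>D. \<exists>c. c \<noteq> 0 \<and> (\<forall>y\<in>S. cubic_norm q (y - d) = c))"

lemma power_power_commute: "(x ^ j) ^ k = (x ^ k) ^ j" for x :: "'a::monoid_mult"
  by (simp add: mult.commute flip: power_mult)

lemma additive_power:
  fixes x y :: "'a::comm_ring_1"
  assumes add: "\<And>x y :: 'a. (x + y) ^ q = x ^ q + y ^ q"
  shows additive_power_diff: "(x - y) ^ q = x ^ q - y ^ q"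
    and additive_power_zero: "(0::'a) ^ q = 0"
    and additive_power_minus: "(- x) ^ q = - (x ^ q)"
proof -
  have diff: "(x - y) ^ q = x ^ q - y ^ q" for x y :: 'a
    using add[of "x - y" y] by (simp add: algebra_simps)
  show "(x - y) ^ q = x ^ q - y ^ q" by (rule diff)
  show zero: "(0::'a) ^ q = 0" using diff[of 0 0] by simp
  show "(- x) ^ q = - (x ^ q)" using diff[of 0 x] zero by simp
qed

text \<open>The two alternatives of \<open>twist\<close> belong to q = 1 and q = 2 modulo 3; in the
  second, Frobenius exchanges the terms with \<open>m\<close> and \<open>w\<close>. Either way it
  maps \<alpha> z to \<alpha> (\<omega> z) and \<beta> z to \<beta> (\<omega> z) and fixes \<xi> z.
  The inequalities \<open>ne\<close> keep the points distinct and the common norm nonzero.\<close>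

lemma configuration_from_twisted_radicals:
  fixes \<omega> r r' m w :: "'a::alg_closed_field"
  assumes frob: "\<And>x y :: 'a. (x + y) ^ q = x ^ q + y ^ q"
    and two: "(2::'a) \<noteq> 0" and three: "(3::'a) \<noteq> 0"
    and \<omega>: "\<omega>\<^sup>2 + \<omega> + 1 = 0" and r: "r * r' = 1"
    and M: "m * w = (1 - r ^ 6) * r' ^ 3"
    and m3: "m ^ 3 = (r ^ 3 - 1) * (r ^ 3 + 1)\<^sup>2 * r' ^ 6"
    and w3: "w ^ 3 = - ((r ^ 3 - 1)\<^sup>2 * (r ^ 3 + 1) * r' ^ 3)"
    and ne: "r ^ 6 \<noteq> 1" "r ^ 6 \<noteq> - 1" "r ^ 6 + 4 * r ^ 3 - 1 \<noteq> 0"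
    and twist: "\<omega> ^ q = \<omega> \<and> r ^ q = r \<and> r' ^ q = r' \<and> m ^ q = \<omega> * m \<and> w ^ q = \<omega>\<^sup>2 * w \<or>
      \<omega> ^ q = \<omega>\<^sup>2 \<and> r ^ q = - r' \<and> r' ^ q = - r \<and> m ^ q = \<omega>\<^sup>2 * w \<and> w ^ q = \<omega> * m"
  shows "\<exists>D S :: 'a set. norm_configuration q D S"
proof -
  define Z where "Z = {z::'a. z ^ 3 = 1}"
  \<comment> \<open>The summand 0, here and in \<xi>, gives all three maps the shape required by
    \<open>inj_on_cube_roots_of_unity\<close>.\<close>
  define \<alpha> where "\<alpha> z = 0 + z * m + z\<^sup>2 * w" for z
  define \<beta> where "\<beta> z = 2 + z * (r * m) + z\<^sup>2 * (- (r' * w))" for z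
  define \<xi> where "\<xi> z = 0 + z * ((r ^ 3 + 1) * r') + z\<^sup>2 * (- ((r ^ 3 - 1) * r'\<^sup>2))" for z
  define c where "c = 2 * (r ^ 3 + r' ^ 3)\<^sup>2"

  have \<omega>3: "\<omega> ^ 3 = 1" using \<omega> by Groebner_Basis.algebra
  have \<omega>1: "\<omega> \<noteq> 1" using \<omega> three by auto
  have cardZ: "card Z = 3" unfolding Z_def using card_nth_roots[of 3 "1::'a"] three by simp
  have \<omega>Z: "\<omega> * z \<in> Z" "\<omega> * z \<noteq> z" if "z \<in> Z" for z
  proof -
    show "\<omega> * z \<in> Z" using that \<omega>3 by (simp add: Z_def power_mult_distrib)
    have "z \<noteq> 0" using that by (auto simp: Z_def)
    then show "\<omega> * z \<noteq> z" using \<omega>1 by simp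
  qed

  note diff = additive_power_diff[OF frob]
  note neg = additive_power_minus[OF frob]
  have two_q: "(2::'a) ^ q = 2" using frob[of 1 1] by simp
  have Z_cases: "z = 1 \<or> z = \<omega> \<or> z = \<omega>\<^sup>2" if "z \<in> Z" for z
  proof -
    have "(z - 1) * (z - \<omega>) * (z - \<omega>\<^sup>2) = z ^ 3 - 1" using \<omega> by Groebner_Basis.algebra
    then show ?thesis using that by (auto simp: Z_def)
  qed
  have zq: "z ^ q = z" if "\<omega> ^ q = \<omega>" "z \<in> Z" for z
    using Z_cases[OF that(2)] that(1) by (auto simp: power_power_commute[of _ _ q])
  have zq': "z ^ q = z\<^sup>2" if "\<omega> ^ q = \<omega>\<^sup>2" "z \<in> Z" for z
    using Z_cases[OF that(2)] that(1) by (auto simp: power_power_commute[of _ _ q])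
  have \<alpha>q: "\<alpha> z ^ q = \<alpha> (\<omega> * z)" and \<beta>q: "\<beta> z ^ q = \<beta> (\<omega> * z)" and \<xi>q: "\<xi> z ^ q = \<xi> z" if "z \<in> Z" for z
  proof -
    have z3: "z ^ 3 = 1" using that by (simp add: Z_def)
    have "\<alpha> z ^ q = \<alpha> (\<omega> * z) \<and> \<beta> z ^ q = \<beta> (\<omega> * z) \<and> \<xi> z ^ q = \<xi> z"
      using twist
    proof (elim disjE conjE)
      assume t: "\<omega> ^ q = \<omega>" "r ^ q = r" "r' ^ q = r'" "m ^ q = \<omega> * m" "w ^ q = \<omega>\<^sup>2 * w"
      show ?thesis
        unfolding \<alpha>_def \<beta>_def \<xi>_def
        by (simp add: frob diff neg two_q power_mult_distrib power_power_commute[of _ _ q] zq[OF t(1) that] t)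
    next
      assume t: "\<omega> ^ q = \<omega>\<^sup>2" "r ^ q = - r'" "r' ^ q = - r" "m ^ q = \<omega>\<^sup>2 * w" "w ^ q = \<omega> * m"
      have "\<alpha> z ^ q = z\<^sup>2 * (\<omega>\<^sup>2 * w) + (z\<^sup>2)\<^sup>2 * (\<omega> * m)"
        "\<beta> z ^ q = 2 + z\<^sup>2 * (- r' * (\<omega>\<^sup>2 * w)) + (z\<^sup>2)\<^sup>2 * (r * (\<omega> * m))"
        "\<xi> z ^ q = z\<^sup>2 * (((- r') ^ 3 + 1) * - r) + (z\<^sup>2)\<^sup>2 * (- (((- r') ^ 3 - 1) * (- r)\<^sup>2))"
        unfolding \<alpha>_def \<beta>_def \<xi>_def
        by (simp_all add: frob diff neg two_q power_mult_distrib power_power_commute[of _ _ q] zq'[OF t(1) that] t)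
      moreover have "z\<^sup>2 * (\<omega>\<^sup>2 * w) + (z\<^sup>2)\<^sup>2 * (\<omega> * m) = \<alpha> (\<omega> * z)"
        "2 + z\<^sup>2 * (- r' * (\<omega>\<^sup>2 * w)) + (z\<^sup>2)\<^sup>2 * (r * (\<omega> * m)) = \<beta> (\<omega> * z)"
        "z\<^sup>2 * (((- r') ^ 3 + 1) * - r) + (z\<^sup>2)\<^sup>2 * (- (((- r') ^ 3 - 1) * (- r)\<^sup>2)) = \<xi> z"
        unfolding \<alpha>_def \<beta>_def \<xi>_def using z3 r by Groebner_Basis.algebra+
      ultimately show ?thesis by simp
    qed
    then show "\<alpha> z ^ q = \<alpha> (\<omega> * z)" "\<beta> z ^ q = \<beta> (\<omega> * z)" "\<xi> z ^ q = \<xi> z" by auto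
  qed
  have \<alpha>3: "\<alpha> (\<omega> * (\<omega> * (\<omega> * z))) = \<alpha> z" and \<beta>3: "\<beta> (\<omega> * (\<omega> * (\<omega> * z))) = \<beta> z" for z
    unfolding \<alpha>_def \<beta>_def using \<omega>3 by Groebner_Basis.algebra+
  have q3: "x ^ (q ^ 3) = ((x ^ q) ^ q) ^ q" for x :: 'a
    by (simp add: power3_eq_cube flip: power_mult)

  have inj\<alpha>: "inj_on \<alpha> Z"
  proof -
    have "m ^ 3 \<noteq> w ^ 3"
    proof
      assume "m ^ 3 = w ^ 3"
      then have "(r ^ 6 - 1) * (r ^ 6 + 1) = 0" unfolding m3 w3 using r by Groebner_Basis.algebra
      then show False using ne by (simp add: eq_neg_iff_add_eq_0)
    qed
    then show ?thesis unfolding \<alpha>_def Z_def by (rule inj_on_cube_roots_of_unity)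
  qed
  have inj\<beta>: "inj_on \<beta> Z"
  proof -
    have "(r * m) ^ 3 \<noteq> (- (r' * w)) ^ 3"
    proof
      assume "(r * m) ^ 3 = (- (r' * w)) ^ 3"
      then have "r ^ 3 * m ^ 3 = - (r' ^ 3 * w ^ 3)" by Groebner_Basis.algebra
      then have "(r ^ 6 - 1) * (r ^ 6 + 1) = 0" unfolding m3 w3 using r by Groebner_Basis.algebra
      then show False using ne by (simp add: eq_neg_iff_add_eq_0)
    qed
    then show ?thesis unfolding \<beta>_def Z_def by (rule inj_on_cube_roots_of_unity)
  qed
  have inj\<xi>: "inj_on \<xi> Z"
  proof -
    have "((r ^ 3 + 1) * r') ^ 3 \<noteq> (- ((r ^ 3 - 1) * r'\<^sup>2)) ^ 3"
    proof
      assume "((r ^ 3 + 1) * r') ^ 3 = (- ((r ^ 3 - 1) * r'\<^sup>2)) ^ 3"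
      then have "(r ^ 6 + 1) * (r ^ 6 + 4 * r ^ 3 - 1) = 0" using r by Groebner_Basis.algebra
      then show False using ne by (simp add: eq_neg_iff_add_eq_0)
    qed
    then show ?thesis unfolding \<xi>_def Z_def by (rule inj_on_cube_roots_of_unity)
  qed
  have disj: "\<beta> ` Z \<inter> \<xi> ` Z = {}"
  proof -
    have "\<beta> z \<noteq> \<xi> z'" if "z \<in> Z" "z' \<in> Z" for z z'
    proof
      assume "\<beta> z = \<xi> z'"
      then have "\<beta> (\<omega> * z) = \<beta> z" using \<beta>q[OF that(1)] \<xi>q[OF that(2)] by simp
      then show False using inj\<beta> \<omega>Z[OF that(1)] that(1) by (auto dest: inj_onD)
    qed
    then show ?thesis by auto
  qed
  have finZ: "finite Z" using cardZ by (intro card_ge_0_finite) simp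
  have "c \<noteq> 0"
  proof
    assume "c = 0"
    then have "r ^ 3 + r' ^ 3 = 0" using two by (simp add: c_def)
    then have "r ^ 6 + 1 = 0" using r by Groebner_Basis.algebra
    then show False using ne by (simp add: eq_neg_iff_add_eq_0)
  qed
  have norm_t: "cubic_norm q (y - \<alpha> z) = (y - \<alpha> z) * (y' - \<alpha> (\<omega> * z)) * (y'' - \<alpha> (\<omega> * (\<omega> * z)))"
    if "z \<in> Z" "y ^ q = y'" "y' ^ q = y''" for y y' y'' z
    using that \<alpha>q[OF that(1)] \<alpha>q[OF \<omega>Z(1)[OF that(1)]] by (simp add: cubic_norm_altdef diff)
  have norm: "cubic_norm q (y - d) = c" if d: "d \<in> \<alpha> ` Z" and y: "y \<in> \<beta> ` Z \<union> \<xi> ` Z" for d y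
  proof -
    obtain z' where z': "z' \<in> Z" "d = \<alpha> z'" using d by auto
    then have z'3: "z' ^ 3 = 1" by (simp add: Z_def)
    from y consider z where "z \<in> Z" "y = \<beta> z" | z where "z \<in> Z" "y = \<xi> z" by auto
    then show ?thesis
    proof cases
      case 1
      then have z3: "z ^ 3 = 1" by (simp add: Z_def)
      have "cubic_norm q (y - d) =
        (2 + (z * r - z') * m + - ((z\<^sup>2 * r' + z'\<^sup>2) * w)) *
        (2 + \<omega> * ((z * r - z') * m) + \<omega>\<^sup>2 * - ((z\<^sup>2 * r' + z'\<^sup>2) * w)) *
        (2 + \<omega>\<^sup>2 * ((z * r - z') * m) + \<omega> * - ((z\<^sup>2 * r' + z'\<^sup>2) * w))"
      proof -
        have "\<beta> z - \<alpha> z' = 2 + (z * r - z') * m + - ((z\<^sup>2 * r' + z'\<^sup>2) * w)"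
          "\<beta> (\<omega> * z) - \<alpha> (\<omega> * z') = 2 + \<omega> * ((z * r - z') * m) + \<omega>\<^sup>2 * - ((z\<^sup>2 * r' + z'\<^sup>2) * w)"
          "\<beta> (\<omega> * (\<omega> * z)) - \<alpha> (\<omega> * (\<omega> * z')) =
             2 + \<omega>\<^sup>2 * ((z * r - z') * m) + \<omega> * - ((z\<^sup>2 * r' + z'\<^sup>2) * w)"
          unfolding \<alpha>_def \<beta>_def using \<omega>3 by Groebner_Basis.algebra+
        then show ?thesis
          using norm_t[OF z'(1) \<beta>q[OF 1(1)] \<beta>q[OF \<omega>Z(1)[OF 1(1)]]] 1 z' by simp
      qed
      also have "\<dots> = 2 * ((z * r) ^ 3 + (z\<^sup>2 * r') ^ 3)\<^sup>2"
      \<comment> \<open>The assumptions contain \<open>r\<close> and \<open>r'\<close> only through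
        their product, cubes and sixth powers, hence also hold for \<open>z * r\<close> and
        \<open>z\<^sup>2 * r'\<close>.\<close>
      proof (rule norm_conjugate_points[OF \<omega> _ z'3 _ _ _ refl refl])
        show "(z * r) * (z\<^sup>2 * r') = 1" using z3 r by Groebner_Basis.algebra
        have e: "(z * r) ^ 3 = r ^ 3" "(z\<^sup>2 * r') ^ 3 = r' ^ 3" using z3 by Groebner_Basis.algebra+
        have e6: "(z * r) ^ 6 = r ^ 6" "(z\<^sup>2 * r') ^ 6 = r' ^ 6" using z3 by Groebner_Basis.algebra+
        show "m * w = (1 - (z * r) ^ 6) * (z\<^sup>2 * r') ^ 3" unfolding e e6 by (rule M)
        show "m ^ 3 = ((z * r) ^ 3 - 1) * ((z * r) ^ 3 + 1)\<^sup>2 * (z\<^sup>2 * r') ^ 6" unfolding e e6 by (rule m3)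
        show "w ^ 3 = - (((z * r) ^ 3 - 1)\<^sup>2 * ((z * r) ^ 3 + 1) * (z\<^sup>2 * r') ^ 3)" unfolding e by (rule w3)
      qed
      also have "\<dots> = c"
      proof -
        have "(z * r) ^ 3 = r ^ 3" "(z\<^sup>2 * r') ^ 3 = r' ^ 3" using z3 by Groebner_Basis.algebra+
        then show ?thesis by (simp add: c_def)
      qed
      finally show ?thesis .
    next
      case 2
      then have z3: "z ^ 3 = 1" by (simp add: Z_def)
      have "cubic_norm q (y - d) = (y - z' * m - z'\<^sup>2 * w) *
        (y - \<omega> * z' * m - \<omega>\<^sup>2 * z'\<^sup>2 * w) * (y - \<omega>\<^sup>2 * z' * m - \<omega> * z'\<^sup>2 * w)"
      proof -
        have yq: "y ^ q = y" using \<xi>q[OF 2(1)] 2(2) by simp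
        have "y - \<alpha> z' = y - z' * m - z'\<^sup>2 * w"
          "y - \<alpha> (\<omega> * z') = y - \<omega> * z' * m - \<omega>\<^sup>2 * z'\<^sup>2 * w"
          "y - \<alpha> (\<omega> * (\<omega> * z')) = y - \<omega>\<^sup>2 * z' * m - \<omega> * z'\<^sup>2 * w"
          unfolding \<alpha>_def using \<omega>3 by Groebner_Basis.algebra+
        then show ?thesis
          unfolding z'(2) norm_t[OF z'(1) yq yq] by (simp only:)
      qed
      also have "\<dots> = c" unfolding c_def
        by (rule norm_rational_points[OF \<omega> r z3 z'3 M m3 w3]) (simp add: 2 \<xi>_def)
      finally show ?thesis .
    qed
  qed
  show ?thesis
    unfolding norm_configuration_def
  proof (intro exI conjI)
    show "card (\<alpha> ` Z) = 3" using card_image[OF inj\<alpha>] cardZ by simp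
    show "card (\<beta> ` Z \<union> \<xi> ` Z) = 6"
      using card_Un_disjoint[OF _ _ disj] finZ card_image[OF inj\<beta>] card_image[OF inj\<xi>] cardZ by simp
    show "\<forall>x\<in>\<alpha> ` Z \<union> (\<beta> ` Z \<union> \<xi> ` Z). x ^ (q ^ 3) = x"
      using \<omega>Z by (auto simp: q3 \<alpha>q \<beta>q \<xi>q \<alpha>3 \<beta>3)
    show "\<forall>d\<in>\<alpha> ` Z. \<exists>c. c \<noteq> 0 \<and> (\<forall>y\<in>\<beta> ` Z \<union> \<xi> ` Z. cubic_norm q (y - d) = c)"
      using norm \<open>c \<noteq> 0\<close> by blast
  qed
qed

section \<open>Choosing the radicals for a given parameter\<close>

text \<open>Only \<open>m\<close> is chosen as a cube root; \<open>w\<close> is defined by the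
  product \<open>m * w\<close>, since an independent cube root would satisfy that equation only up
  to a cube root of unity.\<close>

lemma exists_radicals:
  fixes a :: "'a::alg_closed_field"
  assumes a0: "a \<noteq> 0" and a1: "a\<^sup>2 \<noteq> 1"
  obtains r r' m w where "r ^ 3 = a" "r * r' = 1" "m \<noteq> 0" "w \<noteq> 0"
    "m * w = (1 - r ^ 6) * r' ^ 3"
    "m ^ 3 = (r ^ 3 - 1) * (r ^ 3 + 1)\<^sup>2 * r' ^ 6"
    "w ^ 3 = - ((r ^ 3 - 1)\<^sup>2 * (r ^ 3 + 1) * r' ^ 3)"
proof -
  obtain r where r: "r ^ 3 = a" using nth_root_exists[of 3 a] by auto
  define r' where "r' = 1 / r"
  have r0: "r \<noteq> 0" using r a0 by auto
  then have rr: "r * r' = 1" and r'0: "r' \<noteq> 0" by (simp_all add: r'_def)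
  obtain m where m: "m ^ 3 = (r ^ 3 - 1) * (r ^ 3 + 1)\<^sup>2 * r' ^ 6"
    using nth_root_exists[of 3 "(r ^ 3 - 1) * (r ^ 3 + 1)\<^sup>2 * r' ^ 6"] by auto
  have r6: "r ^ 6 = a\<^sup>2" by (simp add: r[symmetric] flip: power_mult)
  have "(a - 1) * (a + 1) \<noteq> 0" using a1 by (simp add: algebra_simps power2_eq_square)
  then have ne: "a - 1 \<noteq> 0" "a + 1 \<noteq> 0" by auto
  have m0: "m \<noteq> 0" using m ne r r'0 by auto
  define w where "w = (1 - r ^ 6) * r' ^ 3 / m"
  have mw: "m * w = (1 - r ^ 6) * r' ^ 3" using m0 by (simp add: w_def)
  have w0: "w \<noteq> 0" using a1 r6 r'0 m0 by (auto simp: w_def)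
  have "m ^ 3 * w ^ 3 = ((1 - r ^ 6) * r' ^ 3) ^ 3" by (metis mw power_mult_distrib)
  also have "\<dots> = m ^ 3 * (- ((r ^ 3 - 1)\<^sup>2 * (r ^ 3 + 1) * r' ^ 3))"
    unfolding m by Groebner_Basis.algebra
  finally have "w ^ 3 = - ((r ^ 3 - 1)\<^sup>2 * (r ^ 3 + 1) * r' ^ 3)"
    by (rule mult_left_cancel[THEN iffD1, rotated]) (use m0 in simp)
  then show thesis using that r rr m0 w0 mw m by blast
qed

text \<open>
  The norm equations hold for all parameters. What the choice of \<open>a\<close> achieves is that the ten
  points lie in the cubic extension and not in a larger field: \<open>(a - 1) / (a + 1)\<close> must not be
  a cube.
\<close>

lemma configuration_one_mod_3:
  fixes a :: "'a::alg_closed_field"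
  assumes frob: "\<And>x y :: 'a. (x + y) ^ q = x ^ q + y ^ q"
    and two: "(2::'a) \<noteq> 0" and three: "(3::'a) \<noteq> 0" and q: "q = 3 * n + 1"
    and a: "a ^ n = 1" "n > 0" "a\<^sup>2 \<noteq> 1" "a\<^sup>2 \<noteq> - 1" "a\<^sup>2 + 4 * a - 1 \<noteq> 0" and t: "((a - 1) / (a + 1)) ^ n \<noteq> 1"
  shows "\<exists>D S :: 'a set. norm_configuration q D S"
proof -
  have a0: "a \<noteq> 0" using a(1,2) by (auto simp: power_0_left)
  obtain r r' m w where r: "r ^ 3 = a" and rr: "r * r' = 1" and m0: "m \<noteq> 0" and w0: "w \<noteq> 0"
    and mw: "m * w = (1 - r ^ 6) * r' ^ 3"
    and m3: "m ^ 3 = (r ^ 3 - 1) * (r ^ 3 + 1)\<^sup>2 * r' ^ 6"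
    and w3: "w ^ 3 = - ((r ^ 3 - 1)\<^sup>2 * (r ^ 3 + 1) * r' ^ 3)"
    by (rule exists_radicals[OF a0 a(3)])
  have r6: "r ^ 6 = a\<^sup>2" by (simp add: r[symmetric] flip: power_mult)
  have "(a - 1) * (a + 1) \<noteq> 0" using a(3) by (simp add: algebra_simps power2_eq_square)
  then have ne: "a - 1 \<noteq> 0" "a + 1 \<noteq> 0" by auto
  \<comment> \<open>The cubic residue character of (a - 1) / (a + 1), as n = (q - 1) / 3; the
    assumption \<open>t\<close> makes it a primitive cube root of unity.\<close>
  define \<omega> where "\<omega> = ((a - 1) / (a + 1)) ^ n"
  note diff = additive_power_diff[OF frob]
  have aq: "a ^ q = a" by (simp add: q power_add power_mult mult.commute[of 3] a)
  have unit: "x ^ (3 * n) = 1" if "x ^ q = x" "x \<noteq> 0" for x :: 'a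
  proof -
    have "x ^ (3 * n) * x = x" using that(1) by (simp add: q)
    then show ?thesis using that(2) by simp
  qed
  have "((a - 1) / (a + 1)) ^ q = (a - 1) / (a + 1)"
    by (simp add: power_divide frob diff aq)
  then have "((a - 1) / (a + 1)) ^ (3 * n) = 1" using ne by (intro unit) auto
  then have \<omega>3: "\<omega> ^ 3 = 1" by (simp add: \<omega>_def mult.commute flip: power_mult)
  have "(\<omega> - 1) * (\<omega>\<^sup>2 + \<omega> + 1) = 0" using \<omega>3 by Groebner_Basis.algebra
  then have \<omega>: "\<omega>\<^sup>2 + \<omega> + 1 = 0" using t by (simp add: \<omega>_def)
  have \<omega>q: "\<omega> ^ q = \<omega>" by (simp add: q power_add power_mult \<omega>3)
  have rn: "r ^ (3 * n) = 1" using a(1) by (simp add: power_mult r)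
  have rq: "r ^ q = r" by (simp add: q rn)
  have "r ^ q * r' ^ q = 1" by (simp add: rr flip: power_mult_distrib)
  then have "r * r' ^ q = 1" unfolding rq .
  moreover have "x * y = 1 \<Longrightarrow> x * z = 1 \<Longrightarrow> y = z" for x y z :: 'a by Groebner_Basis.algebra
  ultimately have r'q: "r' ^ q = r'" using rr by blast
  have r'n: "r' ^ (3 * n) = 1" using rr by (intro unit r'q) auto
  \<comment> \<open>Up to the cubes (a + 1)^3 and r'^6 of fixed elements, m^3 is (a - 1) / (a + 1),
    so m^(q-1) is its cubic character.\<close>
  have "(m ^ 3) ^ n = ((a - 1) * (a + 1)\<^sup>2 * r' ^ 6) ^ n" by (simp add: m3 r)
  also have "\<dots> = (((a - 1) / (a + 1)) * (a + 1) ^ 3 * r' ^ 6) ^ n"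
    using ne by (simp add: power3_eq_cube power2_eq_square)
  also have "\<dots> = \<omega> * (a + 1) ^ (3 * n) * (r' ^ (3 * n))\<^sup>2"
    unfolding \<omega>_def by (simp only: power_mult_distrib flip: power_mult) (simp add: mult.commute)
  also have "\<dots> = \<omega>"
    using unit[of "a + 1"] ne by (simp add: r'n frob aq)
  finally have mq: "m ^ q = \<omega> * m" by (simp add: q power_mult)
  have "(m * w) ^ q = m * w" by (simp add: mw power_mult_distrib power_power_commute[of _ _ q] diff rq r'q)
  then have w\<omega>: "\<omega> * w ^ q = w" using mq m0 by (simp add: power_mult_distrib ac_simps)
  have "\<omega> ^ 3 * w ^ q = \<omega>\<^sup>2 * (\<omega> * w ^ q)" by (simp add: power2_eq_square power3_eq_cube)
  then have wq: "w ^ q = \<omega>\<^sup>2 * w" unfolding w\<omega> \<omega>3 by simp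
  show ?thesis
    by (rule configuration_from_twisted_radicals[OF frob two three \<omega> rr mw m3 w3])
      (use a \<omega>q rq r'q mq wq in \<open>simp_all add: r r6\<close>)
qed

text \<open>Frobenius now inverts the cube roots of unity, so \<open>a\<close> is not taken fixed by
  it: a^n = - 1 yields a^q = - 1 / a. Then r^q = - 1 / r, and Frobenius maps \<open>m\<close> to a
  multiple of \<open>w\<close> and conversely, as the second alternative of \<open>twist\<close>
  requires.\<close>

lemma configuration_two_mod_3:
  fixes a :: "'a::alg_closed_field"
  assumes frob: "\<And>x y :: 'a. (x + y) ^ q = x ^ q + y ^ q"
    and two: "(2::'a) \<noteq> 0" and three: "(3::'a) \<noteq> 0" and q: "q + 1 = 3 * n"
    and a: "a ^ n = - 1" "a\<^sup>2 \<noteq> 1" "a\<^sup>2 \<noteq> - 1" "a\<^sup>2 + 4 * a - 1 \<noteq> 0" and t: "((a - 1) / (a + 1)) ^ n \<noteq> - 1"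
  shows "\<exists>D S :: 'a set. norm_configuration q D S"
proof -
  have "n > 0" using q by (cases n) auto
  then have a0: "a \<noteq> 0" using a(1) by (auto simp: power_0_left)
  obtain r r' m w where r: "r ^ 3 = a" and rr: "r * r' = 1" and m0: "m \<noteq> 0" and w0: "w \<noteq> 0"
    and mw: "m * w = (1 - r ^ 6) * r' ^ 3"
    and m3: "m ^ 3 = (r ^ 3 - 1) * (r ^ 3 + 1)\<^sup>2 * r' ^ 6"
    and w3: "w ^ 3 = - ((r ^ 3 - 1)\<^sup>2 * (r ^ 3 + 1) * r' ^ 3)"
    by (rule exists_radicals[OF a0 a(2)])
  have r6: "r ^ 6 = a\<^sup>2" by (simp add: r[symmetric] flip: power_mult)
  define b where "b = r' ^ 3"
  have ab: "a * b = 1" unfolding b_def r[symmetric] using rr by Groebner_Basis.algebra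
  have b6: "r' ^ 6 = b\<^sup>2" by (simp add: b_def flip: power_mult)
  have "(a - 1) * (a + 1) \<noteq> 0" using a(2) by (simp add: algebra_simps power2_eq_square)
  then have ne: "a - 1 \<noteq> 0" "a + 1 \<noteq> 0" by auto
  have ab_ne: "a - b \<noteq> 0"
  proof
    assume "a - b = 0"
    then have "a\<^sup>2 = 1" using ab by (simp add: power2_eq_square)
    then show False using a by simp
  qed
  define u where "u = ((a - 1) / (a + 1)) ^ n"
  note diff = additive_power_diff[OF frob]
  have q1: "x ^ (3 * n) = x * x ^ q" for x :: 'a by (simp flip: q)
  have "r * r ^ q = - 1" using a(1) q1[of r] by (simp add: power_mult r)
  moreover have "r * y = - 1 \<Longrightarrow> y = - r'" for y using rr by Groebner_Basis.algebra
  ultimately have rq: "r ^ q = - r'" by blast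
  have "(r * r') ^ q = 1" by (simp add: rr)
  then have "- r' * r' ^ q = 1" by (simp add: power_mult_distrib rq)
  moreover have "- r' * y = 1 \<Longrightarrow> y = - r" for y using rr by Groebner_Basis.algebra
  ultimately have r'q: "r' ^ q = - r" by blast
  have aq: "a ^ q = - b" unfolding r[symmetric] b_def power_power_commute[of _ _ q] rq by simp
  have bq: "b ^ q = - a" unfolding r[symmetric] b_def power_power_commute[of _ _ q] r'q by simp
  have "((a - 1) / (a + 1)) ^ (3 * n) = (a - 1) * (- b - 1) / ((a + 1) * (- b + 1))"
    by (simp add: q1 power_divide frob diff aq)
  also have "(a - 1) * (- b - 1) = - (a - b)" using ab by Groebner_Basis.algebra
  also have eab: "(a + 1) * (- b + 1) = a - b" using ab by Groebner_Basis.algebra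
  also have "- (a - b) / (a - b) = - 1" using ab_ne by (metis divide_minus_left divide_self)
  finally have u3: "u ^ 3 = - 1" by (simp add: u_def mult.commute flip: power_mult)
  \<comment> \<open>\<open>u\<close> is a primitive sixth root of unity, because u^3 = - 1 and
    \<open>t\<close> excludes u = - 1.\<close>
  define \<omega> where "\<omega> = u\<^sup>2"
  have "(u + 1) * (u\<^sup>2 - u + 1) = 0" using u3 by Groebner_Basis.algebra
  moreover have "u + 1 \<noteq> 0" using t by (simp add: u_def eq_neg_iff_add_eq_0)
  ultimately have u2: "u\<^sup>2 - u + 1 = 0" by simp
  have \<omega>: "\<omega>\<^sup>2 + \<omega> + 1 = 0" unfolding \<omega>_def using u2 u3 by Groebner_Basis.algebra
  have \<omega>3: "\<omega> ^ 3 = 1" using \<omega> by Groebner_Basis.algebra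
  have \<omega>2: "\<omega>\<^sup>2 = - u" unfolding \<omega>_def using u3 by Groebner_Basis.algebra
  have "\<omega> * \<omega> ^ q = 1" using q1[of \<omega>] by (simp add: power_mult \<omega>3)
  moreover have "\<omega> * y = 1 \<Longrightarrow> y = \<omega>\<^sup>2" for y using \<omega>3 by Groebner_Basis.algebra
  ultimately have \<omega>q: "\<omega> ^ q = \<omega>\<^sup>2" by blast
  have mw': "m * w = b - a" unfolding mw r6 b_def[symmetric] using ab by Groebner_Basis.algebra
  have bn: "b ^ n = - 1"
  proof -
    have "(a * b) ^ n = 1" by (simp add: ab)
    then have "- (b ^ n) = 1" by (simp add: power_mult_distrib a)
    then show ?thesis by (simp add: minus_equation_iff)
  qed
  have "(m ^ 3) ^ n = ((a - 1) * (a + 1)\<^sup>2 * b\<^sup>2) ^ n" by (simp add: m3 r b6)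
  also have "\<dots> = (((a - 1) / (a + 1)) * (a + 1) ^ 3 * b\<^sup>2) ^ n"
    using ne by (simp add: power3_eq_cube power2_eq_square)
  also have "\<dots> = u * (a + 1) ^ (3 * n) * (b ^ n)\<^sup>2"
    unfolding u_def by (simp only: power_mult_distrib flip: power_mult) (simp add: mult.commute)
  also have "\<dots> = u * (a - b)"
    unfolding q1 frob aq bn using eab by simp
  finally have "m * m ^ q = u * (a - b)" by (simp add: q1 flip: power_mult)
  also have "\<dots> = m * (\<omega>\<^sup>2 * w)" using mw' unfolding \<omega>2 by Groebner_Basis.algebra
  finally have mq: "m ^ q = \<omega>\<^sup>2 * w" using m0 by simp
  have "m ^ q * w ^ q = m * w" unfolding power_mult_distrib[symmetric] mw' by (simp add: diff aq bq)
  then have "\<omega>\<^sup>2 * w ^ q * w = m * w" unfolding mq by (simp add: ac_simps)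
  then have m\<omega>: "\<omega>\<^sup>2 * w ^ q = m" using w0 by simp
  have "\<omega> ^ 3 * w ^ q = \<omega> * (\<omega>\<^sup>2 * w ^ q)" by (simp add: power2_eq_square power3_eq_cube)
  then have wq: "w ^ q = \<omega> * m" unfolding m\<omega> \<omega>3 by simp
  show ?thesis
    by (rule configuration_from_twisted_radicals[OF frob two three \<omega> rr mw m3 w3])
      (use a \<omega>q rq r'q mq wq in \<open>simp_all add: r r6\<close>)
qed

text \<open>
  If \<open>a\<^sup>2 + 4 a - 1 = 0\<close>, then \<open>a\<close> can be replaced by \<open>- a\<close>. The case \<open>a\<^sup>2 = - 1\<close> does not
  occur, as then \<open>(a - 1) / (a + 1) = a\<close>.
\<close>

lemma avoid_degenerate_parameters:
  fixes a e :: "'a::field"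
  assumes n: "even n" "n > 0" and two: "(2::'a) \<noteq> 0" and e: "e\<^sup>2 = 1"
    and a: "a ^ n = e" "a\<^sup>2 \<noteq> 1" "((a - 1) / (a + 1)) ^ n \<noteq> e"
  shows "\<exists>a. a ^ n = e \<and> a\<^sup>2 \<noteq> 1 \<and> a\<^sup>2 \<noteq> - 1 \<and> a\<^sup>2 + 4 * a - 1 \<noteq> 0 \<and> ((a - 1) / (a + 1)) ^ n \<noteq> e"
proof -
  have "(a - 1) * (a + 1) \<noteq> 0" using a(2) by (simp add: algebra_simps power2_eq_square)
  then have ne: "a - 1 \<noteq> 0" "a + 1 \<noteq> 0" by auto
  have a2: "a\<^sup>2 \<noteq> - 1"
  proof
    assume "a\<^sup>2 = - 1"
    then have "a - 1 = a * (a + 1)" by Groebner_Basis.algebra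
    then have "(a - 1) / (a + 1) = a" using ne by (metis nonzero_mult_div_cancel_right)
    then show False using a by simp
  qed
  show ?thesis
  proof (cases "a\<^sup>2 + 4 * a - 1 = 0")
    case False
    then show ?thesis using a a2 by blast
  next
    case True
    \<comment> \<open>Changing the sign of \<open>a\<close> inverts the quotient, and
      \<open>e\<close> is its own inverse.\<close>
    have "((- a - 1) / (- a + 1)) ^ n \<noteq> e"
    proof
      assume *: "((- a - 1) / (- a + 1)) ^ n = e"
      have "- a - 1 = - (a + 1)" "- a + 1 = - (a - 1)" by simp_all
      then have "e = ((a + 1) / (a - 1)) ^ n" using * by (simp only: minus_divide_divide)
      then have "((a - 1) / (a + 1)) ^ n * e = (((a - 1) / (a + 1)) * ((a + 1) / (a - 1))) ^ n"
        by (simp only: power_mult_distrib)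
      then have "((a - 1) / (a + 1)) ^ n * e = 1" using ne by simp
      moreover have "x * e = 1 \<Longrightarrow> x = e" for x using e by Groebner_Basis.algebra
      ultimately have "((a - 1) / (a + 1)) ^ n = e" by blast
      then show False using a by simp
    qed
    moreover have "(- a)\<^sup>2 + 4 * (- a) - 1 \<noteq> 0"
    proof
      assume "(- a)\<^sup>2 + 4 * (- a) - 1 = 0"
      moreover have "2 * (2 * (2 * a)) = (a\<^sup>2 + 4 * a - 1) - ((- a)\<^sup>2 + 4 * (- a) - 1)" by simp
      ultimately have "2 * (2 * (2 * a)) = 0" unfolding True by simp
      then have "a = 0" using two by (metis mult_eq_0_iff)
      then show False using True by simp
    qed
    ultimately show ?thesis
      using a a2 n by (intro exI[of _ "- a"]) (simp add: power_minus_even)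
  qed
qed

text \<open>The excluded values 7 and 13 are those with n = 2 and n = 4 in the first case, and 5 is
  the one with n = 2 in the second; there the comparison of coefficients breaks down.\<close>

lemma configuration_algebraic_closure:
  fixes q :: nat
  assumes frob: "\<And>x y :: 'a::alg_closed_field. (x + y) ^ q = x ^ q + y ^ q"
    and q0: "of_nat q = (0::'a)" and two: "(2::'a) \<noteq> 0" and three: "(3::'a) \<noteq> 0"
    and q: "odd q" "\<not> 3 dvd q" "q \<notin> {1, 5, 7, 13}"
  shows "\<exists>D S :: 'a set. norm_configuration q D S"
proof -
  have "q mod 3 = 1 \<or> q mod 3 = 2" using q(2) by presburger
  then show ?thesis
  proof
    assume "q mod 3 = 1"
    define n where "n = q div 3"
    have qn: "q = 3 * n + 1" using \<open>q mod 3 = 1\<close> unfolding n_def by presburger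
    have "even n" using q(1) qn by simp
    moreover have "n \<noteq> 0" "n \<noteq> 2" "n \<noteq> 4" using q(3) qn by auto
    ultimately have n: "even n" "n \<ge> 6" by presburger+
    have "of_nat (3 * n + 1) = (0::'a)" using q0 qn by simp
    then obtain a :: 'a where "a ^ n = 1" "a\<^sup>2 \<noteq> 1" "((a - 1) / (a + 1)) ^ n \<noteq> 1"
      using exists_homography_not_root_of_unity[OF n _ two] by blast
    then obtain a :: 'a where "a ^ n = 1" "a\<^sup>2 \<noteq> 1" "a\<^sup>2 \<noteq> - 1" "a\<^sup>2 + 4 * a - 1 \<noteq> 0" "((a - 1) / (a + 1)) ^ n \<noteq> 1"
      using avoid_degenerate_parameters[OF n(1) _ two, of 1 a] n(2) by auto
    then show ?thesis
      using configuration_one_mod_3[OF frob two three qn, of a] n(2) by auto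
  next
    assume "q mod 3 = 2"
    define n where "n = (q + 1) div 3"
    have qn: "q + 1 = 3 * n" using \<open>q mod 3 = 2\<close> unfolding n_def by presburger
    have "even n" using q(1) qn by presburger
    moreover have "n \<noteq> 0" "n \<noteq> 2" using q(3) qn by auto
    ultimately have n: "even n" "n \<ge> 4" by presburger+
    have "of_nat (3 * n) = (1::'a)" using q0 by (simp flip: qn)
    then obtain a :: 'a where "a ^ n = - 1" "a\<^sup>2 \<noteq> 1" "((a - 1) / (a + 1)) ^ n \<noteq> - 1"
      using exists_homography_not_root_of_minus_one[OF n _ two] by blast
    then obtain a :: 'a where "a ^ n = - 1" "a\<^sup>2 \<noteq> 1" "a\<^sup>2 \<noteq> - 1" "a\<^sup>2 + 4 * a - 1 \<noteq> 0" "((a - 1) / (a + 1)) ^ n \<noteq> - 1"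
      using avoid_degenerate_parameters[OF n(1) _ two, of "- 1" a] n(2) by auto
    then show ?thesis
      using configuration_two_mod_3[OF frob two three qn, of a] by auto
  qed
qed

section \<open>The configurations for q = 5, 7, 13\<close>

text \<open>
  A triple \<open>(x, y, z)\<close> stands for \<open>x + y \<alpha> + z \<alpha>\<^sup>2\<close> where \<open>\<alpha>\<^sup>3 = u \<alpha> + v\<close>; the norm of this
  element is \<open>cubic_norm_form u v (x, y, z)\<close> modulo \<open>q\<close>. The triples below come from a computer search.
\<close>

definition cubic_norm_form :: "int \<Rightarrow> int \<Rightarrow> int \<times> int \<times> int \<Rightarrow> int" where
  "cubic_norm_form u v = (\<lambda>(x, y, z). x ^ 3 + v * y ^ 3 + v\<^sup>2 * z ^ 3 - u * x * y\<^sup>2 + 2 * u * x\<^sup>2 * z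
     + u\<^sup>2 * x * z\<^sup>2 - u * v * y * z\<^sup>2 - 3 * v * x * y * z)"

text \<open>By Vieta, \<open>a\<close>, \<open>b\<close>, \<open>c\<close> are the roots of X^3 - u
  X - v; the product is expanded and expressed by \<open>u\<close> and \<open>v\<close>.\<close>

lemma norm_form_cubic_roots:
  fixes u v a b c :: "'a::comm_ring_1"
  assumes "a + b + c = 0" "a * b + b * c + c * a = - u" "a * b * c = v"
  shows "(x + y * a + z * a\<^sup>2) * (x + y * b + z * b\<^sup>2) * (x + y * c + z * c\<^sup>2) =
    x ^ 3 + v * y ^ 3 + v\<^sup>2 * z ^ 3 - u * x * y\<^sup>2 + 2 * u * x\<^sup>2 * z
     + u\<^sup>2 * x * z\<^sup>2 - u * v * y * z\<^sup>2 - 3 * v * x * y * z"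
proof -
  have c: "c = - a - b" using assms(1) by (simp add: algebra_simps eq_neg_iff_add_eq_0)
  have u: "u = a\<^sup>2 + a * b + b\<^sup>2" using assms(2) unfolding c by (simp add: algebra_simps power2_eq_square)
  have v: "v = a * b * (- a - b)" using assms(3) unfolding c by simp
  show ?thesis unfolding u v c by (simp add: algebra_simps power2_eq_square power3_eq_cube)
qed

text \<open>Distinctness is tested by nonzero norms of differences, which turns the whole check into
  integer arithmetic modulo \<open>q\<close>.\<close>

definition small_configuration_check ::
    "nat \<Rightarrow> int \<Rightarrow> int \<Rightarrow> (int \<times> int \<times> int) list \<Rightarrow> (int \<times> int \<times> int) list \<Rightarrow> bool" where
  "small_configuration_check q u v ds ss \<longleftrightarrow> length ds = 3 \<and> length ss = 6 \<and>
     (\<forall>xs\<in>{ds, ss}. \<forall>i<length xs. \<forall>j<i. cubic_norm_form u v (xs ! i - xs ! j) mod int q \<noteq> 0) \<and>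
     (\<forall>d\<in>set ds. cubic_norm_form u v (hd ss - d) mod int q \<noteq> 0 \<and>
        (\<forall>y\<in>set ss. cubic_norm_form u v (y - d) mod int q = cubic_norm_form u v (hd ss - d) mod int q))"

lemma small_configuration:
  fixes \<alpha> \<alpha>' \<alpha>'' :: "'a::field" and u v :: int
  assumes frob: "\<And>x y :: 'a. (x + y) ^ q = x ^ q + y ^ q"
    and char: "\<And>n. of_int n = (0::'a) \<longleftrightarrow> int q dvd n"
    and conj: "\<alpha> ^ q = \<alpha>'" "\<alpha>' ^ q = \<alpha>''" "\<alpha>'' ^ q = \<alpha>"
    and vieta: "\<alpha> + \<alpha>' + \<alpha>'' = 0" "\<alpha> * \<alpha>' + \<alpha>' * \<alpha>'' + \<alpha>'' * \<alpha> = - of_int u" "\<alpha> * \<alpha>' * \<alpha>'' = of_int v"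
    and check: "small_configuration_check q u v ds ss"
  shows "\<exists>D S :: 'a set. norm_configuration q D S"
proof -
  define E where "E t = (\<lambda>(x, y, z). of_int x + of_int y * t + of_int z * t\<^sup>2 :: 'a)" for t
  let ?N = "cubic_norm_form u v"
  note diff = additive_power_diff[OF frob]
  have nat_q: "of_nat n ^ q = (of_nat n :: 'a)" for n
    by (induction n) (simp_all add: additive_power_zero[OF frob] frob)
  have int_q: "of_int n ^ q = (of_int n :: 'a)" for n
    by (cases n rule: int_diff_cases) (simp add: diff nat_q)
  have E_q: "E t p ^ q = E (t ^ q) p" for t p
    unfolding E_def by (simp add: frob int_q power_mult_distrib power_power_commute[of _ _ q] split: prod.splits)
  have E_diff: "E t p - E t p' = E t (p - p')" for t p p'
    unfolding E_def by (simp add: algebra_simps split: prod.splits)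
  have E_q3: "E \<alpha> p ^ (q ^ 3) = E \<alpha> p" for p
    by (simp add: power3_eq_cube power_mult E_q conj)
  have norm: "cubic_norm q (E \<alpha> p) = of_int (?N p)" for p
    unfolding cubic_norm_altdef E_q conj
    by (cases p) (simp add: E_def norm_form_cubic_roots[OF vieta] cubic_norm_form_def)
  have eq_iff: "of_int m = (of_int n :: 'a) \<longleftrightarrow> m mod int q = n mod int q" for m n
    using char[of "m - n"] by (simp add: mod_eq_dvd_iff)
  have nz: "of_int m = (0 :: 'a) \<longleftrightarrow> m mod int q = 0" for m
    using char[of m] by (simp add: dvd_eq_mod_eq_0)
  have sep: "\<forall>xs\<in>{ds, ss}. \<forall>i<length xs. \<forall>j<i. ?N (xs ! i - xs ! j) mod int q \<noteq> 0"
    using check unfolding small_configuration_check_def by (elim conjE)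
  have card: "card (E \<alpha> ` set xs) = length xs" if xs: "xs \<in> {ds, ss}" for xs
  proof -
    have ne: "E \<alpha> (xs ! i) \<noteq> E \<alpha> (xs ! j)" if "i < length xs" "j < i" for i j
    proof
      assume "E \<alpha> (xs ! i) = E \<alpha> (xs ! j)"
      then have "E \<alpha> (xs ! i - xs ! j) = 0" by (simp flip: E_diff)
      then have "of_int (?N (xs ! i - xs ! j)) = (0::'a)" by (simp flip: norm)
      then show False using sep[rule_format, OF xs that] by (simp add: nz)
    qed
    have "distinct (map (E \<alpha>) xs)"
      unfolding distinct_conv_nth using ne by (metis length_map linorder_neqE_nat nth_map)
    then show ?thesis using distinct_card[of "map (E \<alpha>) xs"] by simp
  qed
  have "norm_configuration q (E \<alpha> ` set ds) (E \<alpha> ` set ss)"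
    unfolding norm_configuration_def
  proof (intro conjI ballI)
    show "card (E \<alpha> ` set ds) = 3" "card (E \<alpha> ` set ss) = 6"
      using card[of ds] card[of ss] check by (auto simp: small_configuration_check_def)
    show "x ^ (q ^ 3) = x" if "x \<in> E \<alpha> ` set ds \<union> E \<alpha> ` set ss" for x
      using that E_q3 by auto
    fix d' assume "d' \<in> E \<alpha> ` set ds"
    then obtain d where d: "d \<in> set ds" "d' = E \<alpha> d" by auto
    show "\<exists>c. c \<noteq> 0 \<and> (\<forall>y\<in>E \<alpha> ` set ss. cubic_norm q (y - d') = c)"
      using check d
      by (intro exI[of _ "of_int (?N (hd ss - d))"])
        (auto simp: small_configuration_check_def E_diff norm nz eq_iff)
  qed
  then show ?thesis by blast
qed

lemma exists_depressed_cubic_root: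
  "\<exists>x::'a::alg_closed_field. x ^ 3 = u * x + v"
proof -
  have "degree [:- v, - u, 0, 1 :: 'a:] > 0" by simp
  then obtain x where "poly [:- v, - u, 0, 1:] x = 0" using alg_closed_imp_poly_has_root by blast
  then show ?thesis by (intro exI[of _ x]) (simp add: algebra_simps power3_eq_cube)
qed

lemma small_configuration_5:
  assumes frob: "\<And>x y :: 'a::alg_closed_field. (x + y) ^ 5 = x ^ 5 + y ^ 5"
    and char: "\<And>n. of_int n = (0::'a) \<longleftrightarrow> int 5 dvd n"
  shows "\<exists>D S :: 'a set. norm_configuration 5 D S"
proof -
  obtain \<alpha> :: 'a where \<alpha>: "\<alpha> ^ 3 = 1 * \<alpha> + 2" using exists_depressed_cubic_root by blast
  define \<alpha>' where "\<alpha>' = 2 * \<alpha>\<^sup>2 + \<alpha> + 2"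
  define \<alpha>'' where "\<alpha>'' = - \<alpha> - \<alpha>'"
  have five: "(5::'a) = 0" using char[of 5] by simp
  note diff = additive_power_diff[of 5, OF frob]
  have num: "(2::'a) ^ 5 = 2"
  proof -
    have "(2::'a) ^ 5 = 2 + 6 * 5" by simp
    then show ?thesis unfolding five by simp
  qed
  have c1: "\<alpha> ^ 5 = \<alpha>'" unfolding \<alpha>'_def using \<alpha> by Groebner_Basis.algebra
  have c2: "\<alpha>' ^ 5 = \<alpha>''"
  proof -
    have "\<alpha>' ^ 5 = 2 * (\<alpha> ^ 5)\<^sup>2 + \<alpha> ^ 5 + 2"
      unfolding \<alpha>'_def frob power_mult_distrib num by (simp flip: power_mult)
    \<comment> \<open>The explicit multiple of 5 makes this a consequence of the cubic equation
      alone; the characteristic is applied afterwards.\<close>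
    also have "\<dots> = \<alpha>'' + 5 * (6 * \<alpha>\<^sup>2 + 7 * \<alpha> + 6)"
      unfolding c1 \<alpha>'_def \<alpha>''_def using \<alpha> by Groebner_Basis.algebra
    finally show ?thesis unfolding five by simp
  qed
  have c3: "\<alpha>'' ^ 5 = \<alpha>"
  proof -
    have "\<alpha>'' ^ 5 = (0 - \<alpha>) ^ 5 - \<alpha>' ^ 5" unfolding \<alpha>''_def by (simp add: diff)
    also have "\<dots> = \<alpha>" unfolding diff c1 c2 by (simp add: \<alpha>''_def)
    finally show ?thesis .
  qed
  have v2: "\<alpha> * \<alpha>' + \<alpha>' * \<alpha>'' + \<alpha>'' * \<alpha> = - of_int 1"
  proof -
    have "\<alpha> * \<alpha>' + \<alpha>' * \<alpha>'' + \<alpha>'' * \<alpha> = - 1 - 5 * (3 * \<alpha>\<^sup>2 + 4 * \<alpha> + 3)"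
      unfolding \<alpha>'_def \<alpha>''_def using \<alpha> by Groebner_Basis.algebra
    then show ?thesis unfolding five by simp
  qed
  have v3: "\<alpha> * \<alpha>' * \<alpha>'' = of_int 2"
  proof -
    have "\<alpha> * \<alpha>' * \<alpha>'' = 2 - 5 * (4 * \<alpha>\<^sup>2 + 6 * \<alpha> + 6)"
      unfolding \<alpha>'_def \<alpha>''_def using \<alpha> by Groebner_Basis.algebra
    then show ?thesis unfolding five by simp
  qed
  show ?thesis
    by (rule small_configuration[OF frob char c1 c2 c3 _ v2 v3, where ds = "[(0, 0, 0), (1, 0, 0), (0, 0, 3)]"
          and ss = "[(0, 2, 2), (0, 3, 1), (1, 4, 3), (2, 2, 1), (3, 0, 2), (3, 3, 2)]"])
      (simp add: \<alpha>''_def, code_simp)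
qed

text \<open>For \<alpha>^3 = 2 one has \<alpha>^q = 2^n \<alpha>, and the second divisibility makes
  2^n a primitive cube root of unity, so the conjugates are known explicitly.\<close>

lemma small_configuration_pure_cubic:
  fixes \<tau> :: int
  assumes frob: "\<And>x y :: 'a::alg_closed_field. (x + y) ^ q = x ^ q + y ^ q"
    and char: "\<And>n. of_int n = (0::'a) \<longleftrightarrow> int q dvd n"
    and q: "q = 3 * n + 1" and \<tau>: "int q dvd 2 ^ n - \<tau>" "int q dvd 1 + \<tau> + \<tau>\<^sup>2"
    and check: "small_configuration_check q 0 2 ds ss"
  shows "\<exists>D S :: 'a set. norm_configuration q D S"
proof -
  obtain \<alpha> :: 'a where "\<alpha> ^ 3 = 0 * \<alpha> + 2" using exists_depressed_cubic_root by blast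
  then have \<alpha>: "\<alpha> ^ 3 = 2" by simp
  define t where "t = (of_int \<tau> :: 'a)"
  have "of_int (2 ^ n - \<tau>) = (0::'a)" "of_int (1 + \<tau> + \<tau>\<^sup>2) = (0::'a)" using \<tau> char by blast+
  then have t: "2 ^ n = t" "1 + t + t\<^sup>2 = 0" by (simp_all add: t_def)
  have t3: "t ^ 3 = 1" using t(2) by Groebner_Basis.algebra
  have tq: "t ^ q = t" by (simp add: q power_add power_mult t3)
  have \<alpha>q: "\<alpha> ^ q = t * \<alpha>" by (simp add: q power_add power_mult \<alpha> t)
  show ?thesis
  proof (rule small_configuration[OF frob char _ _ _ _ _ _ check])
    show "\<alpha> ^ q = t * \<alpha>" by fact
    show "(t * \<alpha>) ^ q = t\<^sup>2 * \<alpha>" by (simp add: power_mult_distrib tq \<alpha>q power2_eq_square)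
    show "(t\<^sup>2 * \<alpha>) ^ q = \<alpha>"
      using t3 by (simp add: power2_eq_square power_mult_distrib tq \<alpha>q power3_eq_cube mult.assoc)
    show "\<alpha> + t * \<alpha> + t\<^sup>2 * \<alpha> = 0" using t(2) by Groebner_Basis.algebra
    show "\<alpha> * (t * \<alpha>) + t * \<alpha> * (t\<^sup>2 * \<alpha>) + t\<^sup>2 * \<alpha> * \<alpha> = - of_int 0"
      using t(2) t3 by simp Groebner_Basis.algebra
    show "\<alpha> * (t * \<alpha>) * (t\<^sup>2 * \<alpha>) = of_int 2" using t3 \<alpha> by simp Groebner_Basis.algebra
  qed
qed

lemma small_configuration_7:
  assumes "\<And>x y :: 'a::alg_closed_field. (x + y) ^ 7 = x ^ 7 + y ^ 7"
    and "\<And>n. of_int n = (0::'a) \<longleftrightarrow> int 7 dvd n"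
  shows "\<exists>D S :: 'a set. norm_configuration 7 D S"
  by (rule small_configuration_pure_cubic[OF assms, where n = 2 and \<tau> = 4 and
        ds = "[(0, 0, 0), (1, 0, 0), (0, 3, 2)]" and
        ss = "[(0, 1, 6), (0, 2, 3), (1, 1, 6), (1, 2, 3), (1, 4, 5), (2, 0, 4)]"])
    (simp, simp, simp, code_simp)

lemma small_configuration_13:
  assumes "\<And>x y :: 'a::alg_closed_field. (x + y) ^ 13 = x ^ 13 + y ^ 13"
    and "\<And>n. of_int n = (0::'a) \<longleftrightarrow> int 13 dvd n"
  shows "\<exists>D S :: 'a set. norm_configuration 13 D S"
  by (rule small_configuration_pure_cubic[OF assms, where n = 4 and \<tau> = 3 and
        ds = "[(0, 0, 0), (1, 0, 0), (0, 0, 1)]" and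
        ss = "[(0, 12, 12), (7, 7, 5), (7, 8, 6), (8, 7, 6), (8, 11, 5), (10, 2, 10)]"])
    (simp, simp, simp, code_simp)

section \<open>Descent to the field with \<open>q\<^sup>3\<close> elements\<close>

text \<open>The embedded field already provides as many fixed points as the degree of the equation
  allows.\<close>

lemma fixed_points_subset_range_to_ac:
  fixes x :: "'a::{field,finite} alg_closure"
  assumes "x ^ CARD('a) = x"
  shows "x \<in> range to_ac"
proof -
  have "card {0, 1::'a} \<le> CARD('a)" by (intro card_mono) auto
  then have "CARD('a) \<ge> 2" by simp
  note fixed = fixed_points_of_power[OF this, where ?'a = "'a alg_closure"]
  have "to_ac y ^ CARD('a) = to_ac y" for y :: 'a
    using power_card_UNIV[of y] by (metis to_ac_power)
  then have "range to_ac = {x::'a alg_closure. x ^ CARD('a) = x}"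
    using fixed by (intro card_seteq) (auto simp: card_image inj_to_ac)
  then show ?thesis using assms by auto
qed

text \<open>All points are fixed by the power q^3, hence come from \<open>'a\<close>, and the
  embedding commutes with the norm. The constant for \<open>d\<close> is read off at one fixed point
  \<open>y0\<close>.\<close>

lemma norm_configuration_descend:
  fixes D S :: "'a::{field,finite} alg_closure set"
  assumes "norm_configuration q D S" and q: "CARD('a) = q ^ 3"
  obtains D' S' :: "'a set" and c where "card D' = 3" "card S' = 6"
    "\<And>d. d \<in> D' \<Longrightarrow> c d \<noteq> 0" "\<And>d y. d \<in> D' \<Longrightarrow> y \<in> S' \<Longrightarrow> cubic_norm q (y - d) = c d"
proof -
  have range: "D \<union> S \<subseteq> range to_ac"
  proof
    fix x assume "x \<in> D \<union> S"
    then have "x ^ CARD('a) = x" using assms(1) unfolding q norm_configuration_def by blast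
    then show "x \<in> range to_ac" by (rule fixed_points_subset_range_to_ac)
  qed
  obtain D' where D': "D = to_ac ` D'" using range by (metis Un_subset_iff subset_image_iff)
  obtain S' where S': "S = to_ac ` S'" using range by (metis Un_subset_iff subset_image_iff)
  have card: "card D' = 3" "card S' = 6"
    using assms(1) unfolding norm_configuration_def D' S'
    by (auto simp: card_image inj_on_subset[OF inj_to_ac])
  have "S' \<noteq> {}" using card by auto
  then obtain y0 where y0: "y0 \<in> S'" by auto
  have norm: "to_ac (cubic_norm q x) = cubic_norm q (to_ac x)" for x :: 'a
    by (simp add: cubic_norm_def)
  have "cubic_norm q (y0 - d) \<noteq> 0 \<and> (\<forall>y\<in>S'. cubic_norm q (y - d) = cubic_norm q (y0 - d))"
    if "d \<in> D'" for d
  proof -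
    have "to_ac d \<in> D" using that D' by simp
    then have "\<exists>c. c \<noteq> 0 \<and> (\<forall>y\<in>S. cubic_norm q (y - to_ac d) = c)"
      using assms(1) by (simp add: norm_configuration_def)
    then obtain c where c: "c \<noteq> 0" "\<And>y. y \<in> S' \<Longrightarrow> cubic_norm q (to_ac y - to_ac d) = c"
      using S' by auto
    have "to_ac (cubic_norm q (y - d)) = c" if "y \<in> S'" for y
      using c(2)[OF that] by (simp add: norm)
    then show ?thesis using y0 c(1) by (metis to_ac_0 to_ac_eq_iff)
  qed
  then show thesis using that[OF card, of "\<lambda>d. cubic_norm q (y0 - d)"] by blast
qed

theorem mainTheorem2:
  fixes p k q :: nat and F :: "'a::{field,finite} set"
  assumes "prime p" and "k \<ge> 1" and "q = p ^ k"
    and "p \<noteq> 2" and "p \<noteq> 3"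
    and "CARD('a) = q ^ 3"
    and "is_subfield F" and "card F = q"
  shows "int (card (bipartite_copies 4 6 (projective_norm_graph4 q F)))
           \<ge> (int q ^ 3 - 1) * (int q - 1) * (int q ^ 3 - 24)"
proof -
  have char: "CHAR('a) = p"
  proof -
    \<comment> \<open>Translation by 1 permutes the field, so the cardinality is zero in it and the
      characteristic divides a power of \<open>p\<close>.\<close>
    have "(\<Sum>x\<in>(UNIV::'a set). x + 1) = (\<Sum>x\<in>UNIV. x)"
      by (rule sum.reindex_bij_witness[of _ "\<lambda>x. x - 1" "\<lambda>x. x + 1"]) auto
    then have "of_nat (CARD('a)) = (0::'a)" by (simp add: sum.distrib)
    then have dvd: "CHAR('a) dvd (p ^ k) ^ 3"
      using assms(3,6) by (simp only: of_nat_eq_0_iff_char_dvd)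
    have prime: "prime CHAR('a)"
      using finite_imp_CHAR_pos[where ?'a = 'a] by (intro prime_CHAR_semidom) simp
    then have "CHAR('a) dvd p" using dvd by (meson prime_dvd_power)
    then show ?thesis using prime assms(1) by (simp add: primes_dvd_imp_eq)
  qed
  then have charL: "CHAR('a alg_closure) = p" by simp
  have frob: "(x + y) ^ q = x ^ q + y ^ q" for x y :: "'a alg_closure"
    unfolding assms(3) by (rule freshmans_dream') (use assms(1) charL in auto)
  have "p > 3"
    using prime_gt_1_nat[OF assms(1)] assms(4,5) by linarith
  have p: "\<not> p dvd 2" "\<not> p dvd 3" using \<open>p > 3\<close> by (auto dest: dvd_imp_le)
  have two: "(2::'a) \<noteq> 0" and three: "(3::'a) \<noteq> 0"
    using of_nat_eq_0_iff_char_dvd[of 2, where ?'a = 'a] of_nat_eq_0_iff_char_dvd[of 3, where ?'a = 'a] p char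
    by simp_all
  have twoL: "(2::'a alg_closure) \<noteq> 0" and threeL: "(3::'a alg_closure) \<noteq> 0"
    using of_nat_eq_0_iff_char_dvd[of 2, where ?'a = "'a alg_closure"] of_nat_eq_0_iff_char_dvd[of 3, where ?'a = "'a alg_closure"] p charL
    by simp_all
  have qL: "of_nat q = (0::'a alg_closure)"
    using assms(2,3) by (simp add: of_nat_eq_0_iff_char_dvd char)
  have "odd p" using assms(1,4) by (metis primes_dvd_imp_eq two_is_prime_nat)
  then have "odd q" by (simp add: assms(3))
  have "prime (3::nat)" by simp
  then have "\<not> 3 dvd p" using assms(1,5) by (metis primes_dvd_imp_eq)
  then have "\<not> 3 dvd q" unfolding assms(3) using \<open>prime (3::nat)\<close> by (meson prime_dvd_power)
  have "p ^ 1 \<le> q" unfolding assms(3) using assms(2) \<open>p > 3\<close> by (intro power_increasing) auto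
  moreover have "p \<noteq> 4" using \<open>odd p\<close> by auto
  ultimately have q5: "q \<ge> 5" using \<open>p > 3\<close> by simp
  have "\<exists>D S :: 'a alg_closure set. norm_configuration q D S"
  proof (cases "q \<in> {5, 7, 13}")
    case False
    then show ?thesis
      using configuration_algebraic_closure[OF frob qL twoL threeL \<open>odd q\<close> \<open>\<not> 3 dvd q\<close>] q5 by auto
  next
    case True
    have "prime (5::nat)" "prime (7::nat)" "prime (13::nat)" by simp_all
    then have "prime q" using True by auto
    \<comment> \<open>Here \<open>q\<close> is itself prime, so congruences modulo \<open>q\<close>
      decide which integers vanish in the field.\<close>
    then have "p = q" using assms(1,2,3) by (metis prime_power_iff power_one_right)
    have charq: "of_int n = (0::'a alg_closure) \<longleftrightarrow> int q dvd n" for n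
      using of_int_eq_0_iff_char_dvd[of n, where ?'a = "'a alg_closure"] charL \<open>p = q\<close> by simp
    from True show ?thesis
    proof (elim insertE emptyE)
      assume q: "q = 5"
      show ?thesis using small_configuration_5[where ?'a = "'a alg_closure"] frob charq unfolding q by blast
    next
      assume q: "q = 7"
      show ?thesis using small_configuration_7[where ?'a = "'a alg_closure"] frob charq unfolding q by blast
    next
      assume q: "q = 13"
      show ?thesis using small_configuration_13[where ?'a = "'a alg_closure"] frob charq unfolding q by blast
    qed
  qed
  then obtain D S :: "'a alg_closure set" where "norm_configuration q D S" by blast
  then show ?thesis
    by (rule norm_configuration_descend[OF _ assms(6)])
      (rule bipartite_copies_from_norm_system[OF assms(7,8,6) q5 two three])
qed

end
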